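(* Let $X$ be a thick graph, i.e. an infinite, connected, locally finite graph in which each edge is given length $1$ and which, with its path metric, is thick of order $k$ for some integer $k \ge 0$. Then for every Floyd function $f$, the Floyd boundary $\partial_f X$ is exactly one point. In particular, every finitely generated thick group has trivial Floyd boundary with respect to any Floyd function.
   Context: **General notation.** For a metric space $(X,d)$, $B_x(r)$ is the ball of radius $r$ centered at $x$ (empty if $r<0$), and $N_r(Y)$ is the $r$-neighborhood of a subset $Y\subset X$. The length of a path $p$ is denoted $|p|$. A graph is locally finite if every vertex has finite valence. **Floyd boundary.** A Floyd function is a function $f:\mathbb{Z}^+\to\mathbb{R}^+$ (positive integers to positive reals) such that (a) there is $K\ge 1$ with $1\le \frac{f(n)}{f(n+1)}\le K$ for all $n\in\mathbb{Z}^+$, and (b) $\sum_{n=1}^\infty f(n)<\infty$. One sets $f(0):=f(1)$. Let $X$ be a locally finite connected graph with a basepoint vertex $b$, and let $d$ be its path metric with every edge of length $1$. Let $X_f$ be the same graph, with an edge $e$ between vertices $v_1,v_2$ now given length $f(d(b,\{v_1,v_2\}))$ (the Floyd length of $e$). The Floyd length $|p|_f$ of an edge path $p$ is the sum of the Floyd lengths of its edges, and the Floyd distance $d_f(u,v)$ is the infimum of the Floyd lengths of paths from $u$ to $v$. Let $\bar X_f$ be the Cauchy completion of $(X_f,d_f)$. The Floyd boundary is $\partial_f X=\bar X_f\setminus X$. A Floyd boundary is called trivial if it consists of zero, one or two points. The Floyd boundary of a finitely generated group with respect to $f$ is that of its Cayley graph with respect to a finite generating set (basepoint the identity). **Quasi-geodesics.**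 A path $p:I\to X$ in a metric space is a $C$-quasi-geodesic if for any points (vertices, for edge paths in a graph) $v,v'$ in the image of $p$, $\frac1C d(v,v')-C\le |p(v,v')|\le C d(v,v')+C$, where $p(v,v')$ is the subpath of $p$ from $v$ to $v'$. It is bi-infinite if it is infinite in both directions (both rays into which any of its points divides it have infinite length). **Divergence.** Let $X$ be a metric space, $0<\delta<1$, $\gamma\ge 0$. For $a,b,c\in X$ with $d(c,\{a,b\})=r>0$, let $\mathrm{div}_{\gamma,\delta}(a,b,c)$ be the infimum of $|\alpha|$ over all paths $\alpha$ in $X$ connecting $a$ and $b$ that do not intersect $B_c(\delta r-\gamma)$ ($=\infty$ if there is no such path). The divergence function $\mathrm{Div}_{X,\gamma,\delta}(n)$ is the supremum of $\mathrm{div}_{\gamma,\delta}(a,b,c)$ over all such $a,b,c$ with $d(a,b)\le n$. **Wide spaces.** A metric space $X$ is $C$-wide if (1) any $x\in X$ is in the $C$-neighborhood of some bi-infinite $C$-quasi-geodesic, and (2) there exist constants $0<\delta<1$ and $\gamma\ge 0$ such that $\mathrm{Div}_{X,\gamma,\delta}(n)$ is bounded above by a linear function of $n$ (a function $n\mapsto An+A'$). **Thick spaces.** A metric space is $C$-thick of order $0$ if it is $C$-wide. For $k\ge1$, a metric space $X$ is $C$-thick of order at most $k$ with respect to a collection of subsets $\mathcal Y=\{Y_\alpha\}_{\alpha\in\mathcal A}$ if: (1) $X=\bigcup_{\alpha\in\mathcal A}N_C(Y_\alpha)$; (2) every $Y\in\mathcal Y$ with the induced metric is $C$-thick of order at most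 $k-1$ (with respect to some collection; for $k-1=0$ this means $C$-wide); (3) for every $Y,Y'\in\mathcal Y$ there is a finite sequence $Y=Y_1,Y_2,\dots,Y_m=Y'$ in $\mathcal Y$ such that $N_C(Y_i)\cap Y_{i+1}$ has infinite diameter for $1\le i<m$. $X$ is $C$-thick of order at most $k$ if this holds for some such collection. $X$ is thick of order $k$ if it is $C$-thick of order at most $k$ for some $C>0$ and is not $C'$-thick of order at most $k-1$ for any $C'>0$. **Thick groups.** A finitely generated group is thick if its Cayley graph with respect to a (equivalently, any) finite generating set is a thick space, i.e. thick of order $k$ for some $k$. *)

theory Defs
  imports
    "HOL-Analysis.Analysis"
    "HOL-Algebra.Generated_Groups"
    "Graph_Theory.Digraph_Component"
begin

section \<open>Metric spaces: paths, quasi-geodesics, divergence\<close>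

text \<open>
  A metric space is given as a carrier \<open>M\<close> with a distance function \<open>d\<close> satisfying the library
  predicate \<open>Metric_space M d\<close>. A subset \<open>Y \<subseteq> M\<close> with the induced metric is the pair \<open>Y\<close>, \<open>d\<close>;
  paths in it are paths with values in \<open>Y\<close>.
\<close>

definition neighborhood :: "'a set \<Rightarrow> ('a \<Rightarrow> 'a \<Rightarrow> real) \<Rightarrow> real \<Rightarrow> 'a set \<Rightarrow> 'a set" where
  "neighborhood M d r Y = (\<Union>y\<in>Y. Metric_space.mball M d y r)"

definition infinite_diameter :: "('a \<Rightarrow> 'a \<Rightarrow> real) \<Rightarrow> 'a set \<Rightarrow> bool" where
  "infinite_diameter d S \<longleftrightarrow> (\<forall>B. \<exists>x\<in>S. \<exists>y\<in>S. B < d x y)"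

text \<open>The length of \<open>p\<close> restricted to \<open>J\<close>: the supremum over all finite partitions in \<open>J\<close>.\<close>

definition path_length :: "('a \<Rightarrow> 'a \<Rightarrow> real) \<Rightarrow> (real \<Rightarrow> 'a) \<Rightarrow> real set \<Rightarrow> ereal" where
  "path_length d p J =
    (SUP ts \<in> {ts. sorted ts \<and> set ts \<subseteq> J}.
       ereal (\<Sum>i<length ts - 1. d (p (ts ! i)) (p (ts ! Suc i))))"

definition quasi_geodesic ::
    "'a set \<Rightarrow> ('a \<Rightarrow> 'a \<Rightarrow> real) \<Rightarrow> real \<Rightarrow> real set \<Rightarrow> (real \<Rightarrow> 'a) \<Rightarrow> bool" where
  "quasi_geodesic M d C I p \<longleftrightarrow>
     is_interval I \<and> continuous_map (top_of_set I) (Metric_space.mtopology M d) p \<and>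
     (\<forall>s\<in>I. \<forall>t\<in>I. s \<le> t \<longrightarrow>
        ereal (1 / C * d (p s) (p t) - C) \<le> path_length d p {s..t} \<and>
        path_length d p {s..t} \<le> ereal (C * d (p s) (p t) + C))"

definition bi_infinite :: "('a \<Rightarrow> 'a \<Rightarrow> real) \<Rightarrow> real set \<Rightarrow> (real \<Rightarrow> 'a) \<Rightarrow> bool" where
  "bi_infinite d I p \<longleftrightarrow>
     (\<forall>t\<in>I. path_length d p (I \<inter> {..t}) = \<infinity> \<and> path_length d p (I \<inter> {t..}) = \<infinity>)"

text \<open>
  Only used for \<open>r = d(c,{a,b}) > 0\<close>. The infimum over the empty set is \<open>\<infinity>\<close>, and the open ball
  is empty for nonpositive radius.
\<close>

definition div_at ::
    "'a set \<Rightarrow> ('a \<Rightarrow> 'a \<Rightarrow> real) \<Rightarrow> real \<Rightarrow> real \<Rightarrow> 'a \<Rightarrow> 'a \<Rightarrow> 'a \<Rightarrow> ereal" where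
  "div_at M d \<gamma> \<delta> a b c =
     (let r = min (d c a) (d c b) in
      INF \<alpha> \<in> {\<alpha>. pathin (Metric_space.mtopology M d) \<alpha> \<and> \<alpha> 0 = a \<and> \<alpha> 1 = b \<and>
                  \<alpha> ` {0..1} \<inter> Metric_space.mball M d c (\<delta> * r - \<gamma>) = {}}.
        path_length d \<alpha> {0..1})"

definition divergence ::
    "'a set \<Rightarrow> ('a \<Rightarrow> 'a \<Rightarrow> real) \<Rightarrow> real \<Rightarrow> real \<Rightarrow> real \<Rightarrow> ereal" where
  "divergence M d \<gamma> \<delta> n =
     (SUP (a, b, c) \<in> {(a, b, c). a \<in> M \<and> b \<in> M \<and> c \<in> M \<and> 0 < min (d c a) (d c b) \<and> d a b \<le> n}.
        div_at M d \<gamma> \<delta> a b c)"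

section \<open>Wide and thick spaces\<close>

definition wide :: "'a set \<Rightarrow> ('a \<Rightarrow> 'a \<Rightarrow> real) \<Rightarrow> real \<Rightarrow> bool" where
  "wide M d C \<longleftrightarrow>
     (\<forall>x\<in>M. \<exists>I p. quasi_geodesic M d C I p \<and> bi_infinite d I p \<and> x \<in> neighborhood M d C (p ` I)) \<and>
     (\<exists>\<delta> \<gamma>. 0 < \<delta> \<and> \<delta> < 1 \<and> 0 \<le> \<gamma> \<and>
        (\<exists>A A'. \<forall>n\<ge>0. divergence M d \<gamma> \<delta> n \<le> ereal (A * n + A')))"

fun thick_at_most :: "nat \<Rightarrow> 'a set \<Rightarrow> ('a \<Rightarrow> 'a \<Rightarrow> real) \<Rightarrow> real \<Rightarrow> bool" where
  "thick_at_most 0 M d C \<longleftrightarrow> wide M d C"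
| "thick_at_most (Suc k) M d C \<longleftrightarrow>
     (\<exists>\<Y>. \<Y> \<subseteq> Pow M \<and>
        M = (\<Union>Y\<in>\<Y>. neighborhood M d C Y) \<and>
        (\<forall>Y\<in>\<Y>. thick_at_most k Y d C) \<and>
        (\<forall>Y\<in>\<Y>. \<forall>Y'\<in>\<Y>. \<exists>Ys. Ys \<noteq> [] \<and> hd Ys = Y \<and> last Ys = Y' \<and> set Ys \<subseteq> \<Y> \<and>
           (\<forall>i. Suc i < length Ys \<longrightarrow>
              infinite_diameter d (neighborhood M d C (Ys ! i) \<inter> Ys ! Suc i))))"

definition thick_of_order :: "nat \<Rightarrow> 'a set \<Rightarrow> ('a \<Rightarrow> 'a \<Rightarrow> real) \<Rightarrow> bool" where
  "thick_of_order k M d \<longleftrightarrow>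
     (\<exists>C>0. thick_at_most k M d C) \<and> (k \<ge> 1 \<longrightarrow> \<not> (\<exists>C'>0. thick_at_most (k - 1) M d C'))"

definition thick :: "'a set \<Rightarrow> ('a \<Rightarrow> 'a \<Rightarrow> real) \<Rightarrow> bool" where
  "thick M d \<longleftrightarrow> (\<exists>k. thick_of_order k M d)"

section \<open>Metric graphs\<close>

text \<open>
  An undirected graph, possibly with loops and multiple edges, is represented by a
  \<open>wf_digraph\<close> in which every edge has been given an arbitrary orientation; the orientation only
  serves to parametrize the edge. \<open>Digraph_Component.connected\<close> disregards it.
\<close>

fun edge_path :: "('v, 'e) pre_digraph \<Rightarrow> 'v \<Rightarrow> 'e list \<Rightarrow> 'v \<Rightarrow> bool" where
  "edge_path G u [] v \<longleftrightarrow> u \<in> verts G \<and> u = v"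
| "edge_path G u (e # es) v \<longleftrightarrow>
     e \<in> arcs G \<and> (\<exists>x. {tail G e, head G e} = {u, x} \<and> edge_path G x es v)"

definition locally_finite :: "('v, 'e) pre_digraph \<Rightarrow> bool" where
  "locally_finite G \<longleftrightarrow> (\<forall>v\<in>verts G. finite (in_arcs G v \<union> out_arcs G v))"

definition graph_dist :: "('v, 'e) pre_digraph \<Rightarrow> 'v \<Rightarrow> 'v \<Rightarrow> nat" where
  "graph_dist G u v = Inf {length es |es. edge_path G u es v}"

text \<open>
  Points of the geometric realization: \<open>Inner e t\<close>, for \<open>0 < t < 1\<close>, divides \<open>e\<close> in the ratio
  \<open>t : 1 - t\<close>, starting from the tail.
\<close>

datatype ('v, 'e) point = Vertex 'v | Inner 'e real

definition points :: "('v, 'e) pre_digraph \<Rightarrow> ('v, 'e) point set" where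
  "points G = Vertex ` verts G \<union> {Inner e t |e t. e \<in> arcs G \<and> 0 < t \<and> t < 1}"

text \<open>
  The path metric in which \<open>e\<close> has length \<open>w e\<close>: two points are joined by a segment inside
  a common edge, or by leaving each point to an endpoint of its edge and joining these endpoints
  by an edge path. Off the realization the value is \<open>0\<close>, since \<open>Metric_space\<close> demands
  nonnegativity everywhere.
\<close>

fun ends :: "('v, 'e) pre_digraph \<Rightarrow> ('e \<Rightarrow> real) \<Rightarrow> ('v, 'e) point \<Rightarrow> ('v \<times> real) set" where
  "ends G w (Vertex v) = {(v, 0)}"
| "ends G w (Inner e t) = {(tail G e, t * w e), (head G e, (1 - t) * w e)}"

definition path_metric ::
    "('v, 'e) pre_digraph \<Rightarrow> ('e \<Rightarrow> real) \<Rightarrow> ('v, 'e) point \<Rightarrow> ('v, 'e) point \<Rightarrow> real" where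
  "path_metric G w x y =
     (if x \<in> points G \<and> y \<in> points G then
        Inf ({\<bar>s - t\<bar> * w e |e s t. x = Inner e s \<and> y = Inner e t} \<union>
             {l + sum_list (map w es) + l' |l l' es u v.
                (u, l) \<in> ends G w x \<and> (v, l') \<in> ends G w y \<and> edge_path G u es v})
      else 0)"

definition thick_graph :: "('v, 'e) pre_digraph \<Rightarrow> bool" where
  "thick_graph X \<longleftrightarrow>
     wf_digraph X \<and> infinite (verts X) \<and> Digraph_Component.connected X \<and> locally_finite X \<and>
     thick (points X) (path_metric X (\<lambda>_. 1))"

section \<open>The Floyd boundary\<close>

text \<open>The value at \<open>0\<close> is irrelevant; \<open>floyd_length\<close> uses \<open>f (max 1 n)\<close> to implement \<open>f(0) := f(1)\<close>.\<close>

definition floyd_function :: "(nat \<Rightarrow> real) \<Rightarrow> bool" where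
  "floyd_function f \<longleftrightarrow>
     (\<forall>n\<ge>1. 0 < f n) \<and>
     (\<exists>K\<ge>1. \<forall>n\<ge>1. 1 \<le> f n / f (n + 1) \<and> f n / f (n + 1) \<le> K) \<and>
     summable (\<lambda>n. f (Suc n))"

definition floyd_length :: "('v, 'e) pre_digraph \<Rightarrow> 'v \<Rightarrow> (nat \<Rightarrow> real) \<Rightarrow> 'e \<Rightarrow> real" where
  "floyd_length X b f e =
     f (max 1 (min (graph_dist X b (tail X e)) (graph_dist X b (head X e))))"

text \<open>
  The Cauchy completion as the set of classes of Cauchy sequences modulo distance tending to \<open>0\<close>,
  and the canonical embedding by constant sequences.
\<close>

definition cauchy_rel ::
    "'a set \<Rightarrow> ('a \<Rightarrow> 'a \<Rightarrow> real) \<Rightarrow> ((nat \<Rightarrow> 'a) \<times> (nat \<Rightarrow> 'a)) set" where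
  "cauchy_rel M d =
     {(\<sigma>, \<tau>). Metric_space.MCauchy M d \<sigma> \<and> Metric_space.MCauchy M d \<tau> \<and>
             (\<lambda>n. d (\<sigma> n) (\<tau> n)) \<longlonglongrightarrow> 0}"

definition cauchy_completion :: "'a set \<Rightarrow> ('a \<Rightarrow> 'a \<Rightarrow> real) \<Rightarrow> (nat \<Rightarrow> 'a) set set" where
  "cauchy_completion M d = {\<sigma>. Metric_space.MCauchy M d \<sigma>} // cauchy_rel M d"

definition completion_embedding ::
    "'a set \<Rightarrow> ('a \<Rightarrow> 'a \<Rightarrow> real) \<Rightarrow> 'a \<Rightarrow> (nat \<Rightarrow> 'a) set" where
  "completion_embedding M d x = cauchy_rel M d `` {\<lambda>_. x}"

definition floyd_boundary ::
    "('v, 'e) pre_digraph \<Rightarrow> 'v \<Rightarrow> (nat \<Rightarrow> real) \<Rightarrow> (nat \<Rightarrow> ('v, 'e) point) set set" where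
  "floyd_boundary X b f =
     (let d\<^sub>f = path_metric X (floyd_length X b f) in
      cauchy_completion (points X) d\<^sub>f - completion_embedding (points X) d\<^sub>f ` points X)"

definition trivial_boundary :: "'a set \<Rightarrow> bool" where
  "trivial_boundary B \<longleftrightarrow> finite B \<and> card B \<le> 2"

section \<open>Groups\<close>

definition finite_generating_set :: "('g, 'm) monoid_scheme \<Rightarrow> 'g set \<Rightarrow> bool" where
  "finite_generating_set G S \<longleftrightarrow> finite S \<and> S \<subseteq> carrier G \<and> generate G S = carrier G"

definition cayley_graph :: "('g, 'm) monoid_scheme \<Rightarrow> 'g set \<Rightarrow> ('g, 'g \<times> 'g) pre_digraph" where
  "cayley_graph G S =
     \<lparr>verts = carrier G, arcs = carrier G \<times> S, tail = fst, head = (\<lambda>(g, s). g \<otimes>\<^bsub>G\<^esub> s)\<rparr>"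

definition thick_group :: "('g, 'm) monoid_scheme \<Rightarrow> bool" where
  "thick_group G \<longleftrightarrow>
     group G \<and>
     (\<exists>S. finite_generating_set G S \<and>
        thick (points (cayley_graph G S)) (path_metric (cayley_graph G S) (\<lambda>_. 1)))"

end

theory Submission
  imports Defs
begin

text \<open>
  A path \<open>p\<close> whose distance from the base point grows at least linearly in the arc length has Floyd
  length at most a tail of \<open>\<Sum> f\<close>. Of the two rays of a quasi-geodesic issuing from a point far
  from the base point, one is such a path. Hence every far point of a wide subset, and so every far
  point of a thick subset, can be moved to infinity inside it at small Floyd cost, uniformly over all
  such subsets. In a wide subset two points at the same large distance are joined, by linear
  divergence, by a path of comparable length far from the base point, hence of small Floyd length; so
  all far points of a wide subset are Floyd close. For a thick subset this passes along the chains of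
  pieces with unbounded overlaps; the cost of moving a point to infinity being uniform over the pieces,
  points of different pieces can be compared at infinity. So far vertices are Floyd close to
  each other, which leaves exactly one boundary point. Two generating sets of a group give
  bilipschitz graphs, and the dilatation is absorbed by rescaling the Floyd function.
\<close>

section \<open>Arc length as a supremum over inscribed polygons\<close>

section \<open>Length of paths\<close>

text \<open>Two points at very different distances from the base point cannot be joined directly:
  linear divergence bounds the detour by a multiple of their mutual distance, while the ball it
  avoids is measured by the nearer of the two. So far points are first pushed out to a prescribed
  level, at a cost that does not depend on the level.

  The other obstacle is uniformity. The radius beyond which the points of a wide piece are Floyd
  close depends on the piece, because its divergence constants and its position relative to the base
  point are not governed by \<open>C\<close>. The radius for pushing points outwards depends only on
  \<open>C\<close>, the order and the tolerance. In the inductive step, therefore, the pieces near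
  two given points are fixed first, and a level is chosen for this pair of pieces afterwards.

  A piece need not contain the base point, so distances to it are taken in the ambient space. The
  graph enters only through a pointwise estimate of the Floyd distance by the path distance, which
  restricts to arbitrary subsets with the induced metric.\<close>

definition polygon_length :: "('a \<Rightarrow> 'a \<Rightarrow> real) \<Rightarrow> (real \<Rightarrow> 'a) \<Rightarrow> real list \<Rightarrow> real" where
  "polygon_length d p ts = (\<Sum>i<length ts - 1. d (p (ts ! i)) (p (ts ! Suc i)))"

lemma polygon_length_simps [simp]:
  "polygon_length d p [] = 0"
  "polygon_length d p [x] = 0"
  "polygon_length d p (x # y # ts) = d (p x) (p y) + polygon_length d p (y # ts)"
  by (simp_all add: polygon_length_def sum.lessThan_Suc_shift del: sum.lessThan_Suc)

lemma path_length_polygon: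
  "path_length d p J = (SUP ts \<in> {ts. sorted ts \<and> set ts \<subseteq> J}. ereal (polygon_length d p ts))"
  by (simp add: path_length_def polygon_length_def)

lemma path_length_upper:
  "sorted ts \<Longrightarrow> set ts \<subseteq> J \<Longrightarrow> ereal (polygon_length d p ts) \<le> path_length d p J"
  unfolding path_length_polygon by (rule SUP_upper) auto

lemma path_length_mono: "J \<subseteq> J' \<Longrightarrow> path_length d p J \<le> path_length d p J'"
  unfolding path_length_polygon by (rule SUP_subset_mono) auto

lemma path_length_nonneg: "0 \<le> path_length d p J"
  using path_length_upper[of "[]" J d p] by (simp add: zero_ereal_def)

lemma path_length_ge_dist:
  "s \<in> J \<Longrightarrow> t \<in> J \<Longrightarrow> s \<le> t \<Longrightarrow> ereal (d (p s) (p t)) \<le> path_length d p J"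
  using path_length_upper[of "[s, t]" J d p] by simp

lemma polygon_length_append:
  assumes "\<And>x y. 0 \<le> d x y"
  shows "polygon_length d p ts + polygon_length d p us \<le> polygon_length d p (ts @ us)"
proof (induction ts rule: induct_list012)
  case (2 x)
  then show ?case using assms by (cases us) auto
qed auto

text \<open>Concatenate partitions. Together with \<open>path_length_ge_dist\<close> this bounds a
  distance by an increment of arc length.\<close>

lemma path_length_add:
  assumes "\<And>x y. 0 \<le> d x y" "s \<le> t" "t \<le> u"
  shows "path_length d p {s..t} + path_length d p {t..u} \<le> path_length d p {s..u}"
proof -
  have *: "ereal (polygon_length d p ts) + ereal (polygon_length d p us) \<le> path_length d p {s..u}"
    if "sorted ts" "set ts \<subseteq> {s..t}" "sorted us" "set us \<subseteq> {t..u}" for ts us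
  proof -
    have "x \<le> y" if "x \<in> set ts" "y \<in> set us" for x y
      using subsetD[OF \<open>set ts \<subseteq> {s..t}\<close> that(1)] subsetD[OF \<open>set us \<subseteq> {t..u}\<close> that(2)] by simp
    then have "sorted (ts @ us)"
      using that(1,3) by (simp add: sorted_append)
    moreover have "set (ts @ us) \<subseteq> {s..u}"
      using that(2,4) assms(2,3) subset_trans[of "set ts" "{s..t}" "{s..u}"]
        subset_trans[of "set us" "{t..u}" "{s..u}"] by simp
    ultimately have "ereal (polygon_length d p (ts @ us)) \<le> path_length d p {s..u}"
      by (rule path_length_upper)
    moreover have "ereal (polygon_length d p ts) + ereal (polygon_length d p us)
        \<le> ereal (polygon_length d p (ts @ us))"
      using polygon_length_append[of d p ts us] assms(1) by simp
    ultimately show ?thesis by order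
  qed
  have **: "ereal (polygon_length d p ts) + path_length d p {t..u} \<le> path_length d p {s..u}"
    if "sorted ts" "set ts \<subseteq> {s..t}" for ts
    unfolding path_length_polygon[of _ _ "{t..u}"]
  proof (subst SUP_ereal_add_right[symmetric])
    show "{ts. sorted ts \<and> set ts \<subseteq> {t..u}} \<noteq> {}"
      by (auto intro: exI[of _ "[]"])
  qed (use *[OF that] in \<open>auto intro!: SUP_least\<close>)
  show ?thesis
    unfolding path_length_polygon[of _ _ "{s..t}"]
  proof (subst SUP_ereal_add_left[symmetric])
    show "{ts. sorted ts \<and> set ts \<subseteq> {s..t}} \<noteq> {}"
      by (auto intro: exI[of _ "[]"])
    show "path_length d p {t..u} \<noteq> - \<infinity>"
      using path_length_nonneg[of d p "{t..u}"] by auto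
  qed (auto intro!: SUP_least **)
qed

lemma polygon_length_reflect:
  assumes "\<And>x y. d x y = d y x"
  shows "polygon_length d (\<lambda>t. p (- t)) (rev (map uminus ts)) = polygon_length d p ts"
proof -
  let ?n = "length ts - 1"
  let ?g = "\<lambda>i. d (p (ts ! i)) (p (ts ! Suc i))"
  have "polygon_length d (\<lambda>t. p (- t)) (rev (map uminus ts)) = (\<Sum>i<?n. ?g (?n - Suc i))"
    unfolding polygon_length_def
  proof (rule sum.cong)
    fix i assume "i \<in> {..<?n}"
    then have "i < ?n" by simp
    define j where "j = ?n - Suc i"
    have "i < length ts" "Suc i < length ts" "length ts - Suc i = Suc j" "length ts - Suc (Suc i) = j"
        "j < length ts" "Suc j < length ts"
      using \<open>i < ?n\<close> by (auto simp: j_def)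
    then have "- rev (map uminus ts) ! i = ts ! Suc j" "- rev (map uminus ts) ! Suc i = ts ! j"
      by (simp_all add: rev_nth)
    then show "d (p (- rev (map uminus ts) ! i)) (p (- rev (map uminus ts) ! Suc i))
        = ?g (?n - Suc i)"
      unfolding j_def[symmetric] by (simp only: assms[of "p (ts ! Suc j)" "p (ts ! j)"])
  qed simp
  also have "\<dots> = polygon_length d p ts"
    unfolding polygon_length_def by (rule sum.nat_diff_reindex)
  finally show ?thesis .
qed

text \<open>Time reversal turns the left ray of a quasi-geodesic into a right ray.\<close>

lemma path_length_reflect:
  assumes "\<And>x y. d x y = d y x"
  shows "path_length d (\<lambda>t. p (- t)) (uminus ` J) = path_length d p J"
proof -
  have le: "path_length d p J \<le> path_length d (\<lambda>t. p (- t)) (uminus ` J)" for p J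
    unfolding path_length_polygon[of _ _ J]
  proof (rule SUP_least, clarify)
    fix ts :: "real list"
    assume "sorted ts" "set ts \<subseteq> J"
    then have "sorted (rev (map uminus ts))" "set (rev (map uminus ts)) \<subseteq> uminus ` J"
      by (auto simp: sorted_wrt_rev sorted_wrt_map)
    then have "ereal (polygon_length d (\<lambda>t. p (- t)) (rev (map uminus ts)))
        \<le> path_length d (\<lambda>t. p (- t)) (uminus ` J)"
      by (rule path_length_upper)
    then show "ereal (polygon_length d p ts) \<le> path_length d (\<lambda>t. p (- t)) (uminus ` J)"
      using polygon_length_reflect[of d p ts] assms by simp
  qed
  have "path_length d (\<lambda>t. p (- t)) (uminus ` J) \<le> path_length d (\<lambda>t. p (- (- t))) (uminus ` uminus ` J)"
    by (rule le)
  then show ?thesis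
    using le[of p J] by (simp add: image_image)
qed

text \<open>A finite partition has a last point, so a polygon longer than \<open>B\<close> already
  lies over a compact segment.\<close>

lemma path_length_half_line_infinite:
  assumes "path_length d p (I \<inter> {t..}) = \<infinity>" "t \<in> I"
  obtains u where "u \<in> I" "t \<le> u" "ereal B < path_length d p {t..u}"
proof -
  have "ereal B < path_length d p (I \<inter> {t..})"
    using assms by simp
  then obtain ts where ts: "sorted ts" "set ts \<subseteq> I \<inter> {t..}" "B < polygon_length d p ts"
    unfolding path_length_polygon by (auto simp: less_SUP_iff)
  define u where "u = (if ts = [] then t else last ts)"
  have u: "u \<in> I" "t \<le> u"
    using subsetD[OF ts(2) last_in_set] assms(2) by (auto simp: u_def)
  have "x \<le> u" if x: "x \<in> set ts" for x
  proof -
    obtain i where i: "i < length ts" "x = ts ! i"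
      using x by (auto simp: in_set_conv_nth)
    have "ts ! i \<le> ts ! (length ts - 1)"
      by (rule sorted_nth_mono[OF ts(1)]) (use i(1) in auto)
    moreover have "ts \<noteq> []" using i(1) by auto
    ultimately show ?thesis
      by (simp add: u_def last_conv_nth i(2))
  qed
  then have "set ts \<subseteq> {t..u}"
    using ts(2) by auto
  then have "ereal (polygon_length d p ts) \<le> path_length d p {t..u}"
    using ts(1) by (intro path_length_upper)
  with ts(3) have "ereal B < path_length d p {t..u}"
    by (meson less_ereal.simps(1) less_le_trans)
  with u show ?thesis using that by blast
qed

lemma (in Metric_space) continuous_map_eps_delta:
  fixes I :: "real set"
  assumes "continuous_map (top_of_set I) mtopology p" "t \<in> I" "0 < e"
  shows "\<exists>\<eta>>0. \<forall>s\<in>I. \<bar>s - t\<bar> < \<eta> \<longrightarrow> d (p t) (p s) < e"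
proof -
  obtain U where U: "openin (top_of_set I) U" "t \<in> U" "\<forall>y\<in>U. p y \<in> mball (p t) e"
    using assms unfolding continuous_map_to_metric by (metis topspace_euclidean_subtopology)
  then obtain \<eta> where "\<eta> > 0" "\<forall>s\<in>I. dist s t < \<eta> \<longrightarrow> s \<in> U"
    unfolding openin_euclidean_subtopology_iff by metis
  with U show ?thesis by (auto simp: dist_real_def)
qed

section \<open>Conformal change of a metric and the new length of paths\<close>

section \<open>A pair of metrics\<close>

text \<open>\<open>\<phi>\<close> is a conformal factor depending on the distance to
  \<open>b\<close>, and \<open>T r\<close> stands for its integral from \<open>r\<close> to
  infinity, with \<open>T_diff\<close> the lower estimate of an integral of a nonincreasing
  function. In \<open>df_le\<close> the argument of \<open>\<phi>\<close> is lowered by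
  \<open>d x y\<close> because a path from \<open>x\<close> to \<open>y\<close> may approach
  \<open>b\<close> by that much, and by 2 to allow in a graph for partly used edges and for routes
  that are not quite shortest.\<close>

locale conformal_metrics = Metric_space M d for M :: "'a set" and d +
  fixes df :: "'a \<Rightarrow> 'a \<Rightarrow> real" and b :: 'a and \<phi> T :: "real \<Rightarrow> real"
  assumes df_metric: "Metric_space M df"
    and base: "b \<in> M"
    and \<phi>_antimono: "\<And>x y. x \<le> y \<Longrightarrow> \<phi> y \<le> \<phi> x"
    and \<phi>_nonneg: "\<And>x. 0 \<le> \<phi> x"
    and T_diff: "\<And>r s. 0 \<le> r \<Longrightarrow> r \<le> s \<Longrightarrow> (s - r) * \<phi> s \<le> T r - T s"
    and T_tendsto: "(T \<longlongrightarrow> 0) at_top"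
    and df_le: "\<And>x y. x \<in> M \<Longrightarrow> y \<in> M \<Longrightarrow> df x y \<le> d x y * \<phi> (d b x - d x y - 2)"
begin

sublocale F: Metric_space M df by (rule df_metric)

lemma T_antimono: "0 \<le> r \<Longrightarrow> r \<le> s \<Longrightarrow> T s \<le> T r"
  using T_diff[of r s] \<phi>_nonneg[of s] by (smt (verit) mult_nonneg_nonneg)

lemma T_nonneg: "0 \<le> r \<Longrightarrow> 0 \<le> T r"
proof -
  assume r: "0 \<le> r"
  have "eventually (\<lambda>s. T s \<le> T r) at_top"
    by (rule eventually_mono[OF eventually_ge_at_top[of r]]) (use r T_antimono in auto)
  then show ?thesis
    by (intro tendsto_upperbound[OF T_tendsto]) auto
qed

lemma \<phi>_le_T: "1 \<le> r \<Longrightarrow> \<phi> r \<le> T (r - 1)"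
  using T_diff[of "r - 1" r] T_nonneg[of r] by simp

lemma T_small:
  assumes "0 < (e::real)"
  obtains r where "0 \<le> r" "\<And>s. r \<le> s \<Longrightarrow> T s < e"
proof -
  have "eventually (\<lambda>s. T s < e) at_top"
    using T_tendsto assms by (rule order_tendstoD)
  then obtain r where "\<And>s. r \<le> s \<Longrightarrow> T s < e"
    unfolding eventually_at_top_linorder by blast
  then show ?thesis using that[of "max 0 r"] by simp
qed

lemma near_points:
  assumes "0 < e" "0 < C"
  obtains R where "\<And>x y. x \<in> M \<Longrightarrow> y \<in> M \<Longrightarrow> R \<le> d b x \<Longrightarrow> d x y < C \<Longrightarrow> df x y < e"
proof -
  obtain r where r: "0 \<le> r" "\<And>s. r \<le> s \<Longrightarrow> T s < e / C"
    using T_small[of "e / C"] assms by auto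
  show ?thesis
  \<comment> \<open>This radius keeps the argument of \<open>\<phi>\<close> at least
    \<open>r + 1\<close>, where \<open>\<phi>\<close> is at most \<open>T r\<close>.\<close>
  proof (rule that[of "r + C + 3"])
    fix x y assume xy: "x \<in> M" "y \<in> M" "r + C + 3 \<le> d b x" "d x y < C"
    have "\<phi> (d b x - d x y - 2) \<le> \<phi> (r + 1)"
      using xy by (intro \<phi>_antimono) auto
    also have "\<dots> < e / C"
      using \<phi>_le_T[of "r + 1"] r(2)[of r] r(1) by auto
    finally have *: "\<phi> (d b x - d x y - 2) < e / C" .
    have "df x y \<le> d x y * \<phi> (d b x - d x y - 2)"
      using df_le xy by auto
    also have "\<dots> \<le> C * \<phi> (d b x - d x y - 2)"
      using xy(4) \<phi>_nonneg by (intro mult_right_mono) auto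
    also have "\<dots> < C * (e / C)"
      using * assms by (intro mult_strict_left_mono) auto
    also have "\<dots> = e" using assms by simp
    finally show "df x y < e" .
  qed
qed

text \<open>
  The hypothesis says that \<open>p t\<close> has distance at least \<open>\<kappa> \<ell> + c\<close> from the base point, where
  \<open>\<ell>\<close> is the length of \<open>p\<close> up to \<open>t\<close>. Integrating the conformal factor \<open>\<phi>\<close> in arc length then
  gives at most \<open>1/\<kappa>\<close> times a tail of the integral of \<open>\<phi>\<close>.
\<close>

lemma path_small:
  assumes inM: "\<And>t. t \<in> {u..v} \<Longrightarrow> p t \<in> M"
    and cont: "\<And>t e. t \<in> {u..v} \<Longrightarrow> 0 < e \<Longrightarrow> \<exists>\<eta>>0. \<forall>s\<in>{u..v}. \<bar>s - t\<bar> < \<eta> \<longrightarrow> d (p t) (p s) < e"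
    and "u \<le> v" "0 < \<kappa>" "3 \<le> c"
    and far: "\<And>t. t \<in> {u..v} \<Longrightarrow> path_length d p {u..t} \<le> ereal ((d b (p t) - c) / \<kappa>)"
  shows "df (p u) (p v) \<le> T (c - 3) / \<kappa>"
proof -
  define l where "l t = real_of_ereal (path_length d p {u..t})" for t
  have l: "path_length d p {u..t} = ereal (l t)" if "t \<in> {u..v}" for t
    using far[OF that] path_length_nonneg[of d p "{u..t}"]
    by (cases "path_length d p {u..t}") (auto simp: l_def)
  have l_nonneg: "0 \<le> l t" for t
    using path_length_nonneg[of d p "{u..t}"] by (simp add: l_def real_of_ereal_pos)
  have l_far: "\<kappa> * l t + c \<le> d b (p t)" if "t \<in> {u..v}" for t
    using far[OF that] \<open>0 < \<kappa>\<close> unfolding l[OF that] by (simp add: field_simps)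
  have l_diff: "d (p s) (p t) \<le> l t - l s" if "u \<le> s" "s \<le> t" "t \<le> v" for s t
  proof -
    have "ereal (l s) + ereal (d (p s) (p t)) \<le> path_length d p {u..s} + path_length d p {s..t}"
      using that l[of s] path_length_ge_dist[of s "{s..t}" t d p] by (intro add_mono) auto
    also have "\<dots> \<le> path_length d p {u..t}"
      using that by (intro path_length_add) auto
    also have "\<dots> = ereal (l t)" using l[of t] that by auto
    finally show ?thesis by simp
  qed
  \<comment> \<open>The 3 consists of the 2 in \<open>df_le\<close> and of the 1 that bounds the
    steps of a fine subdivision.\<close>
  define h where "h t = \<kappa> * l t + c - 3" for t
  have h_nonneg: "0 \<le> h t" for t
    using mult_nonneg_nonneg[OF less_imp_le[OF \<open>0 < \<kappa>\<close>] l_nonneg[of t]] \<open>3 \<le> c\<close> by (simp add: h_def)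
  \<comment> \<open>The bound telescopes over adjacent intervals, so it only has to be shown on
    short intervals around each point.\<close>
  have "u \<le> u \<and> u \<le> v \<and> v \<le> v \<longrightarrow> df (p u) (p v) \<le> (T (h u) - T (h v)) / \<kappa>"
    using \<open>u \<le> v\<close>
  proof (induction rule: Bolzano[where P =
      "\<lambda>s t. u \<le> s \<and> s \<le> t \<and> t \<le> v \<longrightarrow> df (p s) (p t) \<le> (T (h s) - T (h t)) / \<kappa>"])
    case (trans x y z)
    show ?case
    proof
      assume "u \<le> x \<and> x \<le> z \<and> z \<le> v"
      then have "df (p x) (p z) \<le> df (p x) (p y) + df (p y) (p z)"
        using trans by (intro F.triangle inM) auto
      also have "\<dots> \<le> (T (h x) - T (h y)) / \<kappa> + (T (h y) - T (h z)) / \<kappa>"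
        using trans \<open>u \<le> x \<and> x \<le> z \<and> z \<le> v\<close> by (intro add_mono) auto
      also have "\<dots> = (T (h x) - T (h z)) / \<kappa>"
        by (simp add: diff_divide_distrib)
      finally show "df (p x) (p z) \<le> (T (h x) - T (h z)) / \<kappa>" .
    qed
  next
    case (local x)
    obtain \<eta> where \<eta>: "\<eta> > 0" "\<forall>s\<in>{u..v}. \<bar>s - x\<bar> < \<eta> \<longrightarrow> d (p x) (p s) < 1/2"
      using cont[of x "1/2"] local by auto
    have "df (p s) (p t) \<le> (T (h s) - T (h t)) / \<kappa>"
      if "s \<le> x" "x \<le> t" "t - s < \<eta>" "u \<le> s" "t \<le> v" for s t
    proof -
      have "s \<in> {u..v}" "t \<in> {u..v}" "x \<in> {u..v}"
        using that by auto
      then have M: "p s \<in> M" "p t \<in> M" "p x \<in> M"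
        using inM by auto
      have "d (p x) (p s) < 1/2" "d (p x) (p t) < 1/2"
        using \<eta> that by auto
      then have near: "d (p t) (p s) < 1"
        using triangle''[OF M(2) M(3) M(1)] by linarith
      \<comment> \<open>Swapped so that \<open>\<phi>\<close> is evaluated at the later point, as
        \<open>T_diff\<close> requires.\<close>
      have "df (p s) (p t) = df (p t) (p s)" by (rule F.commute)
      also have "\<dots> \<le> d (p t) (p s) * \<phi> (d b (p t) - d (p t) (p s) - 2)"
        by (rule df_le[OF M(2,1)])
      also have "\<dots> \<le> d (p t) (p s) * \<phi> (h t)"
        using near l_far[OF \<open>t \<in> {u..v}\<close>] by (intro mult_left_mono \<phi>_antimono) (auto simp: h_def)
      also have "\<dots> \<le> (l t - l s) * \<phi> (h t)"
        using l_diff[of s t] that by (intro mult_right_mono \<phi>_nonneg) (auto simp: commute)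
      also have "\<dots> = (h t - h s) * \<phi> (h t) / \<kappa>"
        using \<open>0 < \<kappa>\<close> by (simp add: h_def field_simps)
      also have "\<dots> \<le> (T (h s) - T (h t)) / \<kappa>"
      proof (intro divide_right_mono T_diff h_nonneg)
        have "0 \<le> l t - l s"
          using l_diff[of s t] that by (smt (verit) nonneg)
        then show "h s \<le> h t"
          using \<open>0 < \<kappa>\<close> by (simp add: h_def)
      qed (use \<open>0 < \<kappa>\<close> in auto)
      finally show ?thesis .
    qed
    then show ?case
      using \<eta>(1) by (intro exI[of _ \<eta>]) blast
  qed
  then have "df (p u) (p v) \<le> (T (h u) - T (h v)) / \<kappa>"
    using \<open>u \<le> v\<close> by simp
  also have "\<dots> \<le> T (c - 3) / \<kappa>"
    using T_nonneg[OF h_nonneg[of v]] T_antimono[of "c - 3" "h u"] l_nonneg[of u] assms(4,5)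
    by (intro divide_right_mono) (auto simp: h_def)
  finally show ?thesis .
qed

end

section \<open>Moving points outwards along quasi-geodesic rays\<close>

lemma neighborhood_iff:
  assumes "Metric_space M d"
  shows "x \<in> neighborhood M d C Y \<longleftrightarrow> (\<exists>y\<in>Y. y \<in> M \<and> x \<in> M \<and> d y x < C)"
  by (simp add: neighborhood_def Metric_space.in_mball[OF assms])

context conformal_metrics
begin

text \<open>While the ray is below level \<open>S\<close> it is within \<open>R + S\<close> of its
  start, which bounds the length used so far; infinite length thus forces it up to \<open>S\<close>,
  and the intermediate value theorem gives that level exactly. The Floyd cost comes from
  \<open>path_small\<close> and does not involve \<open>S\<close>.\<close>

lemma ray_moves:
  fixes p :: "real \<Rightarrow> 'a"
  assumes I: "is_interval I" and t0: "t0 \<in> I" and inM: "\<And>t. t \<in> I \<Longrightarrow> p t \<in> M"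
    and cont: "\<And>t e. t \<in> I \<Longrightarrow> 0 < e \<Longrightarrow> \<exists>\<eta>>0. \<forall>s\<in>I. \<bar>s - t\<bar> < \<eta> \<longrightarrow> d (p t) (p s) < e"
    and C: "1 \<le> C"
    and upper: "\<And>s t. s \<in> I \<Longrightarrow> t \<in> I \<Longrightarrow> s \<le> t \<Longrightarrow>
      path_length d p {s..t} \<le> ereal (C * d (p s) (p t) + C)"
    and inf: "path_length d p (I \<inter> {t0..}) = \<infinity>"
    and avoid: "\<And>t. t \<in> I \<Longrightarrow> t0 \<le> t \<Longrightarrow> d b (p t0) \<le> (4 * C + 2) * d b (p t)"
    and big: "32 * C + 16 \<le> d b (p t0)" and S: "d b (p t0) \<le> S"
  shows "\<exists>t\<in>I. d b (p t) = S \<and> df (p t0) (p t) \<le> 4 * C * (4 * C + 2) * T (d b (p t0) / (8 * C + 4) - 4)"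
proof -
  define R where "R = d b (p t0)"
  \<comment> \<open>With \<open>D = 4 * C + 2\<close>, \<open>avoid\<close> gives distance
    \<open>g \<ge> R / D\<close> from \<open>b\<close>, while arc length is at most
    \<open>C * (R + g + 1)\<close>. The offset \<open>c\<close> is half of \<open>R / D\<close>,
    less 1; the inequality wanted is then the sum of \<open>3 * R \<le> 3 * D * g\<close>,
    \<open>g \<le> D * g\<close> and \<open>1 \<le> 4 * D\<close>. The hypothesis \<open>big\<close>
    says exactly that \<open>c \<ge> 3\<close>.\<close>
  define c where "c = R / (8 * C + 4) - 1"
  define \<kappa> where "\<kappa> = 1 / (4 * C * (4 * C + 2))"
  have sub: "{s..t} \<subseteq> I" if "s \<in> I" "t \<in> I" for s t
    using I that unfolding is_interval_1 by (meson atLeastAtMost_iff subsetI)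
  have dist_le: "d (p t0) (p t) \<le> R + d b (p t)" if "t \<in> I" for t
    unfolding R_def using triangle''[OF inM[OF t0] base inM[OF that]] by simp
  obtain t1 where t1: "t1 \<in> I" "t0 \<le> t1" "ereal (C * (R + S) + C) < path_length d p {t0..t1}"
    using path_length_half_line_infinite[OF inf t0] by blast
  have "S \<le> d b (p t1)"
  proof (rule ccontr)
    assume "\<not> S \<le> d b (p t1)"
    then have "C * d (p t0) (p t1) \<le> C * (R + S)"
      using dist_le[OF t1(1)] C by (intro mult_left_mono) auto
    then have "path_length d p {t0..t1} \<le> ereal (C * (R + S) + C)"
      using upper[OF t0 t1(1,2)] by (meson add_right_mono ereal_less_eq(3) order_trans)
    with t1(3) show False by simp
  qed
  moreover have "continuous_on {t0..t1} (\<lambda>t. d b (p t))"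
    unfolding continuous_on_iff
  proof safe
    fix t e :: real assume te: "t \<in> {t0..t1}" "0 < e"
    then have "t \<in> I" using sub[OF t0 t1(1)] by blast
    then obtain \<eta> where \<eta>: "\<eta> > 0" "\<And>s. s \<in> I \<Longrightarrow> \<bar>s - t\<bar> < \<eta> \<Longrightarrow> d (p t) (p s) < e"
      using cont[OF _ te(2)] by metis
    have "dist (d b (p s)) (d b (p t)) < e" if "s \<in> {t0..t1}" "dist s t < \<eta>" for s
    proof -
      have "s \<in> I" using that sub[OF t0 t1(1)] by blast
      then have "d (p t) (p s) < e" using \<eta>(2) that by (simp add: dist_real_def)
      moreover have "\<bar>d (p s) b - d b (p t)\<bar> \<le> d (p s) (p t)"
        using mdist_reverse_triangle[OF inM[OF \<open>s \<in> I\<close>] base inM[OF \<open>t \<in> I\<close>]] .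
      ultimately show ?thesis by (simp add: dist_real_def commute)
    qed
    then show "\<exists>\<eta>>0. \<forall>s\<in>{t0..t1}. dist s t < \<eta> \<longrightarrow> dist (d b (p s)) (d b (p t)) < e"
      using \<eta>(1) by blast
  qed
  ultimately obtain t where t: "t0 \<le> t" "t \<le> t1" "d b (p t) = S"
    using IVT'[of "\<lambda>t. d b (p t)" t0 S t1] S t1(2) by auto
  have "t \<in> I" using t sub[OF t0 t1(1)] by auto
  have "df (p t0) (p t) \<le> T (c - 3) / \<kappa>"
  proof (rule path_small)
    have J: "{t0..t} \<subseteq> I" by (rule sub[OF t0 \<open>t \<in> I\<close>])
    show "p s \<in> M" if "s \<in> {t0..t}" for s
      using that J inM by blast
    show "\<exists>\<eta>>0. \<forall>r\<in>{t0..t}. \<bar>r - s\<bar> < \<eta> \<longrightarrow> d (p s) (p r) < e" if "s \<in> {t0..t}" "0 < e" for s e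
      using cont[OF subsetD[OF J that(1)] that(2)] J by (meson subsetD)
    show "0 < \<kappa>" using C by (simp add: \<kappa>_def)
    show "3 \<le> c" using C big by (simp add: c_def R_def field_simps)
    show "path_length d p {t0..s} \<le> ereal ((d b (p s) - c) / \<kappa>)" if "s \<in> {t0..t}" for s
    proof -
      have s: "s \<in> I" "t0 \<le> s" using that J by auto
      define D g where "D = 4 * C + 2" and "g = d b (p s)"
      have g: "R \<le> D * g" "0 \<le> g" using avoid[OF s] by (auto simp: R_def D_def g_def)
      have "1 \<le> D" using C by (simp add: D_def)
      have "1 * g \<le> D * g" using C g(2) by (intro mult_right_mono) (auto simp: D_def)
      then have "R + g + 1 \<le> 4 * D * g - 2 * R + 4 * D"
        using g \<open>1 \<le> D\<close> by linarith
      also have "\<dots> = 4 * D * (g - c)"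
        using C by (simp add: D_def c_def field_simps)
      finally have *: "C * (R + g + 1) \<le> C * (4 * D * (g - c))"
        using C by (intro mult_left_mono) auto
      have "C * d (p t0) (p s) + C \<le> C * (R + g) + C"
        using dist_le[OF s(1)] C by (simp add: g_def)
      also have "\<dots> = C * (R + g + 1)" by (simp add: algebra_simps)
      also have "\<dots> \<le> (g - c) / \<kappa>"
        using * by (simp add: \<kappa>_def D_def algebra_simps)
      finally show ?thesis
        using upper[OF t0 s] unfolding g_def by (meson ereal_less_eq(3) order_trans)
    qed
  qed (use t in auto)
  then show ?thesis
    using \<open>t \<in> I\<close> t(3) by (intro bexI[of _ t]) (auto simp: c_def \<kappa>_def R_def algebra_simps)
qed

text \<open>
  A quasi-geodesic that came close to the base point on both sides of \<open>t0\<close> would join two close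
  points by a long path; so one of the two rays from \<open>p t0\<close> stays far from the base point.
\<close>

lemma bi_infinite_moves:
  assumes Y: "Y \<subseteq> M" and qg: "quasi_geodesic Y d C' I p" and bi: "bi_infinite d I p"
    and t0: "t0 \<in> I" and C: "1 \<le> C" "C' \<le> C"
    and big: "32 * C + 16 \<le> d b (p t0)" and S: "d b (p t0) \<le> S"
  shows "\<exists>y\<in>Y. d b y = S \<and> df (p t0) y \<le> 4 * C * (4 * C + 2) * T (d b (p t0) / (8 * C + 4) - 4)"
proof -
  interpret Y: Metric_space Y d by (rule subspace[OF Y])
  have I: "is_interval I" and cm: "continuous_map (top_of_set I) Y.mtopology p"
    using qg by (auto simp: quasi_geodesic_def)
  have inY: "p t \<in> Y" if "t \<in> I" for t
    using continuous_map_funspace[OF cm] that by (auto simp: Pi_iff)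
  have cont: "\<exists>\<eta>>0. \<forall>s\<in>I. \<bar>s - t\<bar> < \<eta> \<longrightarrow> d (p t) (p s) < e" if "t \<in> I" "0 < e" for t e
    using Y.continuous_map_eps_delta[OF cm that] .
  have upper: "path_length d p {s..t} \<le> ereal (C * d (p s) (p t) + C)"
    if "s \<in> I" "t \<in> I" "s \<le> t" for s t
  proof -
    have "path_length d p {s..t} \<le> ereal (C' * d (p s) (p t) + C')"
      using qg that by (auto simp: quasi_geodesic_def)
    also have "\<dots> \<le> ereal (C * d (p s) (p t) + C)"
      using C by (auto intro!: add_mono mult_right_mono)
    finally show ?thesis .
  qed
  let ?E = "4 * C * (4 * C + 2) * T (d b (p t0) / (8 * C + 4) - 4)"
  have "\<exists>t\<in>I. d b (p t) = S \<and> df (p t0) (p t) \<le> ?E"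
  proof (cases "\<forall>t\<in>I. t0 \<le> t \<longrightarrow> d b (p t0) \<le> (4 * C + 2) * d b (p t)")
    case True
    show ?thesis
      by (rule ray_moves[OF I t0 _ cont C(1) upper]) (use True inY Y bi t0 big S in \<open>auto simp: bi_infinite_def\<close>)
  next
    case False
    then obtain t1 where t1: "t1 \<in> I" "t0 \<le> t1" "(4 * C + 2) * d b (p t1) < d b (p t0)"
      by (auto simp: not_le)
    \<comment> \<open>Put \<open>R = d b (p t0)\<close>. With visits within
      \<open>R / (4 * C + 2)\<close> of \<open>b\<close> on both sides, the subpath between them has
      length at most \<open>2 * C * R / (4 * C + 2) + C\<close>, but it runs through
      \<open>p t0\<close>, at distance at least \<open>R - R / (4 * C + 2)\<close> from its start.
      The factor is chosen so that this reduces to \<open>R \<le> 2 * C\<close>.\<close>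
    have left: "d b (p t0) \<le> (4 * C + 2) * d b (p s)" if "s \<in> I" "s \<le> t0" for s
    proof (rule ccontr)
      assume "\<not> ?thesis"
      then have s: "(4 * C + 2) * d b (p s) < d b (p t0)" by simp
      have M: "p s \<in> M" "p t0 \<in> M" "p t1 \<in> M"
        using inY that t0 t1 Y by auto
      have "ereal (d (p s) (p t0)) \<le> path_length d p {s..t1}"
        using that t1(2) by (intro path_length_ge_dist) auto
      also have "\<dots> \<le> ereal (C * d (p s) (p t1) + C)"
        using that t1 by (intro upper) auto
      finally have "d (p s) (p t0) \<le> C * d (p s) (p t1) + C" by simp
      also have "\<dots> \<le> C * (d b (p s) + d b (p t1)) + C"
        using triangle''[OF M(1) base M(3)] C(1) by (intro add_right_mono mult_left_mono) auto
      finally have 1: "d (p s) (p t0) \<le> C * (d b (p s) + d b (p t1)) + C" .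
      have "d b (p t0) \<le> d b (p s) + d (p s) (p t0)"
        by (rule triangle[OF base M(1,2)])
      with 1 have "d b (p t0) \<le> (C + 1) * d b (p s) + C * d b (p t1) + C"
        by (simp add: algebra_simps)
      then have "(4 * C + 2) * d b (p t0) \<le> (4 * C + 2) * ((C + 1) * d b (p s) + C * d b (p t1) + C)"
        using C(1) by (intro mult_left_mono) auto
      also have "\<dots> = (C + 1) * ((4 * C + 2) * d b (p s)) + C * ((4 * C + 2) * d b (p t1)) + (4 * C + 2) * C"
        by (simp add: algebra_simps)
      also have "\<dots> \<le> (C + 1) * d b (p t0) + C * d b (p t0) + (4 * C + 2) * C"
        using s t1(3) C(1) by (intro add_mono mult_left_mono) auto
      finally have "(2 * C + 1) * d b (p t0) \<le> (2 * C + 1) * (2 * C)"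
        by (simp add: algebra_simps)
      then have "d b (p t0) \<le> 2 * C"
        using C(1) by simp
      with big C(1) show False by simp
    qed
    let ?q = "\<lambda>t. p (- t)" and ?J = "uminus ` I"
    have J: "t \<in> ?J \<longleftrightarrow> - t \<in> I" for t
      by (metis add.inverse_inverse image_iff)
    have "\<exists>t\<in>?J. d b (?q t) = S \<and> df (?q (- t0)) (?q t)
        \<le> 4 * C * (4 * C + 2) * T (d b (?q (- t0)) / (8 * C + 4) - 4)"
    proof (rule ray_moves[OF _ _ _ _ C(1)])
      show "is_interval ?J" using I by simp
      show "\<exists>\<eta>>0. \<forall>s\<in>?J. \<bar>s - t\<bar> < \<eta> \<longrightarrow> d (?q t) (?q s) < e" if te: "t \<in> ?J" "0 < e" for t e
      proof -
        obtain \<eta> where "\<eta> > 0" and \<eta>: "\<forall>s\<in>I. \<bar>s - (- t)\<bar> < \<eta> \<longrightarrow> d (p (- t)) (p s) < e"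
          using cont[of "- t" e] te J by auto
        have "d (?q t) (?q s) < e" if "s \<in> ?J" "\<bar>s - t\<bar> < \<eta>" for s
          using \<eta>[rule_format, of "- s"] that J by (simp add: abs_minus_commute)
        with \<open>\<eta> > 0\<close> show ?thesis by blast
      qed
      show "path_length d ?q {s..t} \<le> ereal (C * d (?q s) (?q t) + C)"
        if "s \<in> ?J" "t \<in> ?J" "s \<le> t" for s t
        using upper[of "- t" "- s"] path_length_reflect[of d p "{- t..- s}"] that J
        by (simp add: commute)
      have "?J \<inter> {- t0..} = uminus ` (I \<inter> {..t0})"
        by (auto simp: J image_iff)
      then show "path_length d ?q (?J \<inter> {- t0..}) = \<infinity>"
        using path_length_reflect[of d p "I \<inter> {..t0}"] bi t0 by (simp add: commute bi_infinite_def)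
    qed (use t0 inY Y left big S J in auto)
    then show ?thesis using J by auto
  qed
  then show ?thesis using inY by blast
qed

text \<open>\<open>R\<close> is fixed before \<open>Y\<close>: no divergence constant enters. The
  level \<open>S\<close> is attained exactly, so that two points can be brought to the same level.
  The margin \<open>C\<close> below \<open>S\<close> is there because the point of the
  quasi-geodesic near \<open>x\<close> may lie further out than \<open>x\<close>.\<close>

lemma wide_moves:
  assumes "0 < C" "0 < e"
  obtains R where "\<And>Y x S. Y \<subseteq> M \<Longrightarrow> wide Y d C \<Longrightarrow> x \<in> Y \<Longrightarrow> R \<le> d b x \<Longrightarrow> d b x + C \<le> S \<Longrightarrow>
    \<exists>y\<in>Y. d b y = S \<and> df x y < e"
proof -
  \<comment> \<open>The constant \<open>C\<close> of a wide space may be less than 1, while the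
    estimates along rays are made for constants at least 1.\<close>
  define C1 where "C1 = max 1 C"
  define K where "K = 4 * C1 * (4 * C1 + 2)"
  have C1: "1 \<le> C1" "C \<le> C1" by (auto simp: C1_def)
  then have "0 < K" by (simp add: K_def)
  obtain r where r: "0 \<le> r" "\<And>s. r \<le> s \<Longrightarrow> T s < e / 2 / K"
    using T_small[of "e / 2 / K"] assms \<open>0 < K\<close> by auto
  obtain R0 where R0: "\<And>x y. x \<in> M \<Longrightarrow> y \<in> M \<Longrightarrow> R0 \<le> d b x \<Longrightarrow> d x y < C \<Longrightarrow> df x y < e / 2"
    using near_points[of "e / 2" C] assms by auto
  show ?thesis
  \<comment> \<open>After the loss of \<open>C\<close> in passing to the quasi-geodesic,
    \<open>(r + 4) * (8 * C1 + 4)\<close> remains; this puts the argument of \<open>T\<close> beyond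
    \<open>r\<close> and contains the bound \<open>32 * C1 + 16\<close>.\<close>
  proof (rule that[of "max R0 ((r + 4) * (8 * C1 + 4) + C)"])
    fix Y x S
    assume Y: "Y \<subseteq> M" and w: "wide Y d C" and x: "x \<in> Y"
      and far: "max R0 ((r + 4) * (8 * C1 + 4) + C) \<le> d b x" and S: "d b x + C \<le> S"
    obtain I p where qg: "quasi_geodesic Y d C I p" "bi_infinite d I p"
        and "x \<in> neighborhood Y d C (p ` I)"
      using w x unfolding wide_def by blast
    then obtain t0 where t0: "t0 \<in> I" "p t0 \<in> Y" "d (p t0) x < C"
      by (auto simp: neighborhood_iff[OF subspace[OF Y]])
    have M: "x \<in> M" "p t0 \<in> M" using x t0 Y by auto
    have "d b x \<le> d b (p t0) + d (p t0) x" by (rule triangle[OF base M(2,1)])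
    then have far': "(r + 4) * (8 * C1 + 4) \<le> d b (p t0)"
      using far t0(3) by simp
    have "d b (p t0) \<le> d b x + d x (p t0)" by (rule triangle[OF base M])
    then have S': "d b (p t0) \<le> S" using S t0(3) commute[of x "p t0"] by simp
    have "4 * (8 * C1 + 4) \<le> (r + 4) * (8 * C1 + 4)"
      using r(1) C1 by (intro mult_right_mono) auto
    with far' have big: "32 * C1 + 16 \<le> d b (p t0)" by simp
    have "r \<le> d b (p t0) / (8 * C1 + 4) - 4"
      using far' C1 by (simp add: field_simps)
    then have "K * T (d b (p t0) / (8 * C1 + 4) - 4) < K * (e / 2 / K)"
      using r(2) \<open>0 < K\<close> by (intro mult_strict_left_mono) auto
    also have "\<dots> = e / 2" using \<open>0 < K\<close> by simp
    finally have small: "K * T (d b (p t0) / (8 * C1 + 4) - 4) < e / 2" .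
    obtain y where y: "y \<in> Y" "d b y = S" "df (p t0) y \<le> K * T (d b (p t0) / (8 * C1 + 4) - 4)"
      using bi_infinite_moves[OF Y qg t0(1) C1 big S'] unfolding K_def by blast
    have "df x y \<le> df x (p t0) + df (p t0) y"
      using M y(1) Y by (intro F.triangle) auto
    also have "\<dots> < e / 2 + e / 2"
      using R0[OF M] far t0(3) y(3) small by (intro add_strict_mono) (auto simp: commute)
    finally show "\<exists>y\<in>Y. d b y = S \<and> df x y < e" using y by auto
  qed
qed

end

text \<open>Chains in the definition of thickness use neighbourhoods inside the piece, whereas
  \<open>close_step\<close> takes them in the ambient space.\<close>

lemma neighborhood_mono:
  assumes "Metric_space M d" "Y \<subseteq> M"
  shows "neighborhood Y d C Z \<subseteq> neighborhood M d C Z"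
proof
  fix x assume "x \<in> neighborhood Y d C Z"
  then obtain y where "y \<in> Z" "y \<in> Y" "x \<in> Y" "d y x < C"
    unfolding neighborhood_iff[OF Metric_space.subspace[OF assms]] by blast
  then show "x \<in> neighborhood M d C Z"
    unfolding neighborhood_iff[OF assms(1)] using assms(2) by blast
qed

lemma thick_at_most_SucE:
  assumes "thick_at_most (Suc k) Y d C"
  obtains \<Y> where "\<Y> \<subseteq> Pow Y" "Y = (\<Union>Z\<in>\<Y>. neighborhood Y d C Z)"
    "\<forall>Z\<in>\<Y>. thick_at_most k Z d C"
    "\<forall>Z\<in>\<Y>. \<forall>Z'\<in>\<Y>. \<exists>Ys. Ys \<noteq> [] \<and> hd Ys = Z \<and> last Ys = Z' \<and> set Ys \<subseteq> \<Y> \<and>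
       (\<forall>i. Suc i < length Ys \<longrightarrow> infinite_diameter d (neighborhood Y d C (Ys ! i) \<inter> Ys ! Suc i))"
  using assms unfolding thick_at_most.simps by (elim exE conjE) (rule that)

section \<open>Closeness at infinity in wide and thick subsets\<close>

context conformal_metrics
begin

text \<open>The threshold may depend on the pair of sets. A bounded set is close to every set, so
  passing from one pair to the next requires an unbounded link.\<close>

definition close :: "'a set \<Rightarrow> 'a set \<Rightarrow> bool" where
  "close S S' \<longleftrightarrow> (\<forall>e>0. \<exists>R. \<forall>x\<in>S. \<forall>y\<in>S'. R \<le> d b x \<longrightarrow> R \<le> d b y \<longrightarrow> df x y < e)"

lemma closeE:
  assumes "close S S'" "0 < e"
  obtains R where "\<And>x y. x \<in> S \<Longrightarrow> y \<in> S' \<Longrightarrow> R \<le> d b x \<Longrightarrow> R \<le> d b y \<Longrightarrow> df x y < e"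
  using assms unfolding close_def by blast

text \<open>At a common level \<open>S\<close> the detour has length at most \<open>K * S\<close>
  and distance at least \<open>\<delta> * S / 2\<close> from \<open>b\<close>. A path whose length
  is bounded by a multiple of its distance from \<open>b\<close> falls under
  \<open>path_small\<close>, even though it does not move away from \<open>b\<close>.\<close>

lemma wide_close:
  assumes Y: "Y \<subseteq> M" and w: "wide Y d C" and "0 < C"
  shows "close Y Y"
proof (cases "Y = {}")
  case True
  then show ?thesis by (simp add: close_def)
next
  case False
  \<comment> \<open>Divergence in \<open>Y\<close> is measured from a centre in \<open>Y\<close>,
    where \<open>b\<close> need not lie; passing between \<open>b\<close> and \<open>c\<close> costs
    at most \<open>D\<close>.\<close>
  then obtain c where c: "c \<in> Y" by blast
  interpret Y: Metric_space Y d by (rule subspace[OF Y])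
  obtain \<delta> \<gamma> A A' where \<delta>: "0 < \<delta>" "\<delta> < 1" and \<gamma>: "0 \<le> \<gamma>"
    and div: "\<And>n. n \<ge> 0 \<Longrightarrow> divergence Y d \<gamma> \<delta> n \<le> ereal (A * n + A')"
    using w unfolding wide_def by blast
  define D where "D = d b c"
  \<comment> \<open>\<open>K * S\<close> exceeds the divergence bound at \<open>2 * S\<close> once
    \<open>S \<ge> 1\<close>. Half of \<open>\<delta> * S / 2\<close> becomes the offset in
    \<open>path_small\<close>, and the other half equals \<open>\<kappa> * (K * S)\<close>.\<close>
  define K where "K = 2 * \<bar>A\<bar> + \<bar>A'\<bar> + 1"
  define \<kappa> where "\<kappa> = \<delta> / (4 * K)"
  have "0 < K" by (simp add: K_def)
  then have "0 < \<kappa>" using \<delta> by (simp add: \<kappa>_def)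
  show ?thesis
    unfolding close_def
  proof (intro allI impI)
    fix e :: real assume "0 < e"
    obtain R where R: "\<And>x S. x \<in> Y \<Longrightarrow> R \<le> d b x \<Longrightarrow> d b x + C \<le> S \<Longrightarrow> \<exists>y\<in>Y. d b y = S \<and> df x y < e / 3"
      using wide_moves[of C "e / 3"] \<open>0 < C\<close> \<open>0 < e\<close> Y w
      by (metis divide_pos_pos zero_less_numeral)
    obtain r where r: "0 \<le> r" "\<And>s. r \<le> s \<Longrightarrow> T s < e / 3 * \<kappa>"
      using T_small[of "e / 3 * \<kappa>"] \<open>0 < e\<close> \<open>0 < \<kappa>\<close> by auto
    \<comment> \<open>In this order the entries absorb the constant term of the divergence bound,
      make the distances from \<open>c\<close> positive, leave \<open>\<delta> * S / 2\<close> after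
      the losses \<open>\<delta> * D\<close>, \<open>\<gamma>\<close> and \<open>D\<close>, and push
      the argument of \<open>T\<close> beyond \<open>r\<close>.\<close>
    define S0 where "S0 = Max {1, D + 1, 2 * (\<delta> * D + \<gamma> + D) / \<delta>, 4 * (r + 3) / \<delta>}"
    have "df x y < e" if x: "x \<in> Y" "max R S0 \<le> d b x" and y: "y \<in> Y" "max R S0 \<le> d b y" for x y
    proof -
      define S where "S = max (d b x) (d b y) + C"
      obtain x' where x': "x' \<in> Y" "d b x' = S" "df x x' < e / 3"
        using R[of x S] x by (auto simp: S_def)
      obtain y' where y': "y' \<in> Y" "d b y' = S" "df y y' < e / 3"
        using R[of y S] y by (auto simp: S_def)
      have M: "x \<in> M" "y \<in> M" "x' \<in> M" "y' \<in> M" "c \<in> M"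
        using x y x' y' c Y by auto
      have "S0 \<le> S" using x \<open>0 < C\<close> by (auto simp: S_def)
      then have S: "1 \<le> S" "D + 1 \<le> S" "2 * (\<delta> * D + \<gamma> + D) / \<delta> \<le> S" "4 * (r + 3) / \<delta> \<le> S"
        by (simp_all add: S0_def)
      have S3: "\<delta> * D + \<gamma> + D \<le> \<delta> * S / 2" and S4: "r + 3 \<le> \<delta> * S / 4"
        using S(3,4) \<delta>(1) by (simp_all add: field_simps)
      define m where "m = min (d c x') (d c y')"
      have "S \<le> D + d c x'" "S \<le> D + d c y'"
        using triangle[OF base M(5,3)] triangle[OF base M(5,4)] x' y' by (auto simp: D_def)
      then have m: "S - D \<le> m" by (simp add: m_def)
      have "d x' y' \<le> 2 * S"
        using triangle''[OF M(3) base M(4)] x' y' by simp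
      have "div_at Y d \<gamma> \<delta> x' y' c \<le> divergence Y d \<gamma> \<delta> (2 * S)"
        unfolding divergence_def
        using x'(1) y'(1) c m S(2) \<open>d x' y' \<le> 2 * S\<close>
        by (intro SUP_upper2[of "(x', y', c)"]) (auto simp: m_def)
      also have "\<dots> \<le> ereal (A * (2 * S) + A')"
        using S(1) by (intro div) auto
      also have "\<dots> < ereal (K * S)"
      proof -
        have "A * S \<le> \<bar>A\<bar> * S" "\<bar>A'\<bar> * 1 \<le> \<bar>A'\<bar> * S"
          using S(1) by (auto intro: mult_right_mono mult_left_mono[of 1 S, simplified])
        moreover have "K * S = 2 * (\<bar>A\<bar> * S) + \<bar>A'\<bar> * S + S"
          by (simp add: K_def algebra_simps)
        ultimately have "A * (2 * S) + A' < K * S"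
          using S(1) by linarith
        then show ?thesis by simp
      qed
      finally obtain \<alpha> where \<alpha>: "pathin Y.mtopology \<alpha>" "\<alpha> 0 = x'" "\<alpha> 1 = y'"
          "\<alpha> ` {0..1} \<inter> Y.mball c (\<delta> * m - \<gamma>) = {}" "path_length d \<alpha> {0..1} < ereal (K * S)"
        unfolding div_at_def Let_def INF_less_iff m_def by blast
      have cm: "continuous_map (top_of_set {0..1}) Y.mtopology \<alpha>"
        using \<alpha>(1) by (simp add: pathin_def)
      have inY: "\<alpha> t \<in> Y" if "t \<in> {0..1}" for t
        using continuous_map_funspace[OF cm] that by (auto simp: Pi_iff)
      have "df (\<alpha> 0) (\<alpha> 1) \<le> T (\<delta> * S / 4 - 3) / \<kappa>"
      proof (rule path_small)
        show "\<exists>\<eta>>0. \<forall>s\<in>{0..1}. \<bar>s - t\<bar> < \<eta> \<longrightarrow> d (\<alpha> t) (\<alpha> s) < \<epsilon>" if "t \<in> {0..1}" "0 < \<epsilon>" for t \<epsilon>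
          using Y.continuous_map_eps_delta[OF cm that] .
        show "3 \<le> \<delta> * S / 4" using S4 r(1) by simp
        show "path_length d \<alpha> {0..t} \<le> ereal ((d b (\<alpha> t) - \<delta> * S / 4) / \<kappa>)" if t: "t \<in> {0..1}" for t
        proof -
          have "\<alpha> t \<notin> Y.mball c (\<delta> * m - \<gamma>)"
            using \<alpha>(4) t by blast
          then have "\<not> d c (\<alpha> t) < \<delta> * m - \<gamma>"
            using inY[OF t] c by simp
          moreover have "\<delta> * (S - D) \<le> \<delta> * m"
            using m \<delta> by (intro mult_left_mono) auto
          moreover have "d c (\<alpha> t) \<le> D + d b (\<alpha> t)"
            using triangle''[OF M(5) base, of "\<alpha> t"] inY[OF t] Y by (auto simp: D_def)
          ultimately have "\<delta> * S / 2 \<le> d b (\<alpha> t)"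
            using S3 by (simp add: algebra_simps)
          then have "K * S \<le> (d b (\<alpha> t) - \<delta> * S / 4) / \<kappa>"
            using \<open>0 < K\<close> \<delta>(1) by (simp add: \<kappa>_def field_simps)
          moreover have "path_length d \<alpha> {0..t} \<le> ereal (K * S)"
            using path_length_mono[of "{0..t}" "{0..1}" d \<alpha>] \<alpha>(5) t by auto
          ultimately show ?thesis
            by (meson ereal_less_eq(3) order_trans)
        qed
      qed (use inY Y \<open>0 < \<kappa>\<close> in auto)
      also have "\<dots> < e / 3"
        using r(2)[of "\<delta> * S / 4 - 3"] S4 \<open>0 < \<kappa>\<close> by (simp add: pos_divide_less_eq)
      finally have "df x' y' < e / 3" using \<alpha> by simp
      moreover have "df x y \<le> df x x' + df x' y" "df x' y \<le> df x' y' + df y' y"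
        using M by (auto intro: F.triangle)
      ultimately show ?thesis
        using x'(3) y'(3) F.commute[of y y'] by linarith
    qed
    then show "\<exists>R. \<forall>x\<in>Y. \<forall>y\<in>Y. R \<le> d b x \<longrightarrow> R \<le> d b y \<longrightarrow> df x y < e"
      by blast
  qed
qed

lemma infinite_diameter_far:
  assumes "infinite_diameter d Z" "Z \<subseteq> M"
  obtains z where "z \<in> Z" "R \<le> d b z"
proof -
  obtain x y where xy: "x \<in> Z" "y \<in> Z" "2 * R < d x y"
    using assms(1) unfolding infinite_diameter_def by blast
  have "d x y \<le> d b x + d b y"
    using xy assms(2) base by (intro triangle'') auto
  then have "R \<le> d b x \<or> R \<le> d b y" using xy(3) by linarith
  with xy that show ?thesis by blast
qed

text \<open>The unbounded overlap contains a far point \<open>z\<close> of \<open>Z\<close> within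
  \<open>C\<close> of a point \<open>y\<close> of \<open>Y\<close>, again far. This single pair is a
  bridge for all far points of \<open>S\<close> and \<open>Z\<close>.\<close>

lemma close_step:
  assumes "close S Y" "close Z Z" and M: "S \<subseteq> M" "Y \<subseteq> M" "Z \<subseteq> M" and "0 < C"
    and inf: "infinite_diameter d (neighborhood M d C Y \<inter> Z)"
  shows "close S Z"
  unfolding close_def
proof (intro allI impI)
  fix e :: real assume "0 < e"
  then have e: "0 < e / 3" by simp
  obtain R1 where R1: "\<And>x y. x \<in> S \<Longrightarrow> y \<in> Y \<Longrightarrow> R1 \<le> d b x \<Longrightarrow> R1 \<le> d b y \<Longrightarrow> df x y < e / 3"
    using closeE[OF assms(1) e] by metis
  obtain R2 where R2: "\<And>x y. x \<in> Z \<Longrightarrow> y \<in> Z \<Longrightarrow> R2 \<le> d b x \<Longrightarrow> R2 \<le> d b y \<Longrightarrow> df x y < e / 3"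
    using closeE[OF assms(2) e] by metis
  obtain R3 where R3: "\<And>x y. x \<in> M \<Longrightarrow> y \<in> M \<Longrightarrow> R3 \<le> d b x \<Longrightarrow> d x y < C \<Longrightarrow> df x y < e / 3"
    using near_points[OF e \<open>0 < C\<close>] by metis
  define R where "R = Max {R1, R2, R3}"
  have R: "R1 \<le> R" "R2 \<le> R" "R3 \<le> R" by (simp_all add: R_def)
  obtain z where z: "z \<in> neighborhood M d C Y \<inter> Z" "R + C \<le> d b z"
    using infinite_diameter_far[OF inf, of "R + C"] M by blast
  then obtain y where y: "y \<in> Y" "d y z < C"
    by (auto simp: neighborhood_iff[OF Metric_space_axioms])
  have inM: "y \<in> M" "z \<in> M" using y z M by auto
  have "d b z \<le> d b y + d y z" by (rule triangle[OF base inM])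
  then have far: "R \<le> d b y" "R \<le> d b z" using z y \<open>0 < C\<close> by auto
  have "df x w < e" if "x \<in> S" "w \<in> Z" "R \<le> d b x" "R \<le> d b w" for x w
  proof -
    have "df x y < e / 3" using R1[of x y] that y far R by linarith
    moreover have "df y z < e / 3" using R3[of y z] inM y far R by linarith
    moreover have "df z w < e / 3" using R2[of z w] that z far R by auto
    moreover have "df x w \<le> df x y + df y w" "df y w \<le> df y z + df z w"
      using that M inM by (auto intro!: F.triangle)
    ultimately show ?thesis by linarith
  qed
  then show "\<exists>R. \<forall>x\<in>S. \<forall>y\<in>Z. R \<le> d b x \<longrightarrow> R \<le> d b y \<longrightarrow> df x y < e"
    by blast
qed

text \<open>Induction on the order: a point is within \<open>C\<close> of some piece, and the piece
  moves the point near it. The quantifier over \<open>Y\<close> stands inside that over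
  \<open>R\<close>; the induction relies on this uniformity, since the piece is not known in
  advance.\<close>

lemma thick_moves:
  assumes "0 < C" "0 < e"
  shows "\<exists>R. \<forall>Y x S. Y \<subseteq> M \<longrightarrow> thick_at_most k Y d C \<longrightarrow> x \<in> Y \<longrightarrow> R \<le> d b x \<longrightarrow>
    (\<exists>y\<in>Y. S \<le> d b y \<and> df x y < e)"
  using \<open>0 < e\<close>
proof (induction k arbitrary: e)
  case 0
  obtain R where R: "\<And>Y x S. Y \<subseteq> M \<Longrightarrow> wide Y d C \<Longrightarrow> x \<in> Y \<Longrightarrow> R \<le> d b x \<Longrightarrow> d b x + C \<le> S \<Longrightarrow>
    \<exists>y\<in>Y. d b y = S \<and> df x y < e"
    using wide_moves[OF \<open>0 < C\<close> 0] by metis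
  have "\<exists>y\<in>Y. S \<le> d b y \<and> df x y < e"
    if "Y \<subseteq> M" "thick_at_most 0 Y d C" "x \<in> Y" "R \<le> d b x" for Y x S
    \<comment> \<open>The exact level of the wide case must lie beyond \<open>d b x + C\<close>; any
      level above both bounds will do.\<close>
    using R[of Y x "max S (d b x + C)"] that by force
  then show ?case by blast
next
  case (Suc k)
  then have e: "0 < e / 2" by simp
  obtain R1 where R1: "\<And>Y x S. Y \<subseteq> M \<Longrightarrow> thick_at_most k Y d C \<Longrightarrow> x \<in> Y \<Longrightarrow> R1 \<le> d b x \<Longrightarrow>
      \<exists>y\<in>Y. S \<le> d b y \<and> df x y < e / 2"
    using Suc.IH[OF e] by metis
  obtain R2 where R2: "\<And>x y. x \<in> M \<Longrightarrow> y \<in> M \<Longrightarrow> R2 \<le> d b x \<Longrightarrow> d x y < C \<Longrightarrow> df x y < e / 2"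
    using near_points[OF e \<open>0 < C\<close>] by metis
  have "\<exists>y\<in>Y. S \<le> d b y \<and> df x y < e"
    if Y: "Y \<subseteq> M" "thick_at_most (Suc k) Y d C" and x: "x \<in> Y" "max R2 (R1 + C) \<le> d b x" for Y x S
  proof -
    obtain \<Y> where \<Y>: "\<Y> \<subseteq> Pow Y" "Y = (\<Union>Z\<in>\<Y>. neighborhood Y d C Z)" "\<forall>Z\<in>\<Y>. thick_at_most k Z d C"
      using thick_at_most_SucE[OF Y(2)] by metis
    then obtain Z where Z: "Z \<in> \<Y>" "x \<in> neighborhood Y d C Z" using x(1) by blast
    then obtain z where z: "z \<in> Z" "d z x < C"
      by (auto simp: neighborhood_iff[OF subspace[OF Y(1)]])
    have ZY: "Z \<subseteq> Y" using Z \<Y> by auto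
    then have M: "x \<in> M" "z \<in> M" using z x Y by auto
    have "d b x \<le> d b z + d z x" by (rule triangle[OF base M(2,1)])
    then have "R1 \<le> d b z" using x z by auto
    then obtain y where y: "y \<in> Z" "S \<le> d b y" "df z y < e / 2"
      using R1[of Z z S] ZY Y(1) \<Y>(3) Z(1) z(1) by auto
    have "df x z < e / 2" using R2[OF M] x z by (simp add: commute)
    moreover have "df x y \<le> df x z + df z y"
      using M y ZY Y by (intro F.triangle) auto
    ultimately show ?thesis using y ZY by (intro bexI[of _ y]) auto
  qed
  then show ?case by blast
qed

lemma thick_close:
  assumes "0 < C" "Y \<subseteq> M" "thick_at_most k Y d C"
  shows "close Y Y"
  using assms(2,3)
proof (induction k arbitrary: Y)
  case 0
  then show ?case using wide_close[of Y C] \<open>0 < C\<close> by simp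
next
  case (Suc k)
  obtain \<Y> where \<Y>: "\<Y> \<subseteq> Pow Y" "Y = (\<Union>Z\<in>\<Y>. neighborhood Y d C Z)" "\<forall>Z\<in>\<Y>. thick_at_most k Z d C"
    and chain: "\<forall>Z\<in>\<Y>. \<forall>Z'\<in>\<Y>. \<exists>Ys. Ys \<noteq> [] \<and> hd Ys = Z \<and> last Ys = Z' \<and> set Ys \<subseteq> \<Y> \<and>
           (\<forall>i. Suc i < length Ys \<longrightarrow>
              infinite_diameter d (neighborhood Y d C (Ys ! i) \<inter> Ys ! Suc i))"
    using thick_at_most_SucE[OF Suc.prems(2)] .
  have sub: "Z \<subseteq> M" if "Z \<in> \<Y>" for Z
    using that \<Y>(1) Suc.prems(1) by blast
  have self: "close Z Z" if "Z \<in> \<Y>" for Z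
    using Suc.IH[OF sub[OF that]] \<Y>(3) that by blast
  \<comment> \<open>Closeness to the fixed first piece is carried along the chain. Each new piece is
    close to itself by the outer induction.\<close>
  have pair: "close Z Z'" if "Z \<in> \<Y>" "Z' \<in> \<Y>" for Z Z'
  proof -
    obtain Ys where Ys: "Ys \<noteq> []" "hd Ys = Z" "last Ys = Z'" "set Ys \<subseteq> \<Y>"
      and inf: "\<And>i. Suc i < length Ys \<Longrightarrow>
        infinite_diameter d (neighborhood Y d C (Ys ! i) \<inter> Ys ! Suc i)"
      using chain[rule_format, OF \<open>Z \<in> \<Y>\<close> \<open>Z' \<in> \<Y>\<close>] by metis
    have "close Z (Ys ! i)" if "i < length Ys" for i
      using that
    proof (induction i)
      case 0
      then show ?case using Ys self \<open>Z \<in> \<Y>\<close> by (metis hd_conv_nth)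
    next
      case (Suc i)
      have in\<Y>: "Ys ! i \<in> \<Y>" "Ys ! Suc i \<in> \<Y>"
        using Ys(4) Suc.prems nth_mem[of i Ys] nth_mem[of "Suc i" Ys] by auto
      have "neighborhood Y d C (Ys ! i) \<inter> Ys ! Suc i \<subseteq> neighborhood M d C (Ys ! i) \<inter> Ys ! Suc i"
        using neighborhood_mono[OF Metric_space_axioms \<open>Y \<subseteq> M\<close>] by blast
      then have "infinite_diameter d (neighborhood M d C (Ys ! i) \<inter> Ys ! Suc i)"
        using inf[OF Suc.prems] unfolding infinite_diameter_def by blast
      then show ?case
        using Suc self[OF in\<Y>(2)] sub in\<Y> \<open>Z \<in> \<Y>\<close> \<open>0 < C\<close>
        by (intro close_step[of Z "Ys ! i" "Ys ! Suc i" C]) auto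
    qed
    from this[of "length Ys - 1"] show ?thesis
      using Ys by (simp add: last_conv_nth)
  qed
  show ?case
    unfolding close_def
  proof (intro allI impI)
    fix e :: real assume "0 < e"
    then have e: "0 < e / 5" by simp
    obtain R1 where R1: "\<And>Y x S. Y \<subseteq> M \<Longrightarrow> thick_at_most k Y d C \<Longrightarrow> x \<in> Y \<Longrightarrow> R1 \<le> d b x \<Longrightarrow>
        \<exists>y\<in>Y. S \<le> d b y \<and> df x y < e / 5"
      using thick_moves[OF \<open>0 < C\<close> e, of k] by metis
    obtain R2 where R2: "\<And>x y. x \<in> M \<Longrightarrow> y \<in> M \<Longrightarrow> R2 \<le> d b x \<Longrightarrow> d x y < C \<Longrightarrow> df x y < e / 5"
      using near_points[OF e \<open>0 < C\<close>] by metis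
    \<comment> \<open>The piece is chosen before \<open>S\<close>, so a threshold for the pair of
      pieces can be taken afterwards. One fifth pays for entering the piece, one for going outwards;
      the fifth fifth is spent between the two pieces.\<close>
    have move: "\<exists>Z\<in>\<Y>. \<forall>S. \<exists>y\<in>Z. S \<le> d b y \<and> df x y < 2 * (e / 5)"
      if x: "x \<in> Y" "max R2 (R1 + C) \<le> d b x" for x
    proof -
      obtain Z where Z: "Z \<in> \<Y>" "x \<in> neighborhood Y d C Z" using x(1) \<Y>(2) by blast
      then obtain z where z: "z \<in> Z" "d z x < C"
        by (auto simp: neighborhood_iff[OF subspace[OF \<open>Y \<subseteq> M\<close>]])
      have M: "x \<in> M" "z \<in> M" using z x \<open>Y \<subseteq> M\<close> sub[OF Z(1)] by auto
      have "d b x \<le> d b z + d z x" by (rule triangle[OF base M(2,1)])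
      then have "R1 \<le> d b z" using x z by auto
      have "df x z < e / 5" using R2[OF M] x z by (simp add: commute)
      have "\<exists>y\<in>Z. S \<le> d b y \<and> df x y < 2 * (e / 5)" for S
      proof -
        obtain y where y: "y \<in> Z" "S \<le> d b y" "df z y < e / 5"
          using R1[of Z z S] sub[OF Z(1)] \<Y>(3) Z(1) z(1) \<open>R1 \<le> d b z\<close> by auto
        moreover have "df x y \<le> df x z + df z y"
          using M y sub[OF Z(1)] by (intro F.triangle) auto
        ultimately show ?thesis using \<open>df x z < e / 5\<close> by (intro bexI[of _ y]) auto
      qed
      then show ?thesis using Z(1) by blast
    qed
    have "df x y < e"
      if x: "x \<in> Y" "max R2 (R1 + C) \<le> d b x" and y: "y \<in> Y" "max R2 (R1 + C) \<le> d b y" for x y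
    proof -
      obtain Z where Z: "Z \<in> \<Y>" "\<And>S. \<exists>x'\<in>Z. S \<le> d b x' \<and> df x x' < 2 * (e / 5)"
        using move[OF x] by blast
      obtain Z' where Z': "Z' \<in> \<Y>" "\<And>S. \<exists>y'\<in>Z'. S \<le> d b y' \<and> df y y' < 2 * (e / 5)"
        using move[OF y] by blast
      obtain R where R: "\<And>x y. x \<in> Z \<Longrightarrow> y \<in> Z' \<Longrightarrow> R \<le> d b x \<Longrightarrow> R \<le> d b y \<Longrightarrow> df x y < e / 5"
        using closeE[OF pair[OF Z(1) Z'(1)] e] by metis
      obtain x' y' where x': "x' \<in> Z" "R \<le> d b x'" "df x x' < 2 * (e / 5)"
        and y': "y' \<in> Z'" "R \<le> d b y'" "df y y' < 2 * (e / 5)"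
        using Z(2)[of R] Z'(2)[of R] by blast
      have "x \<in> M" "y \<in> M" "x' \<in> M" "y' \<in> M"
        using x y x' y' sub[OF Z(1)] sub[OF Z'(1)] \<open>Y \<subseteq> M\<close> by auto
      then have "df x y \<le> df x x' + df x' y" "df x' y \<le> df x' y' + df y' y"
        by (auto intro: F.triangle)
      moreover have "df x' y' < e / 5" using R x' y' by blast
      ultimately show ?thesis using x'(3) y'(3) F.commute[of y y'] by linarith
    qed
    then show "\<exists>R. \<forall>x\<in>Y. \<forall>y\<in>Y. R \<le> d b x \<longrightarrow> R \<le> d b y \<longrightarrow> df x y < e"
      by blast
  qed
qed

end

section \<open>The path metric of a weighted graph\<close>

context wf_digraph
begin

lemma edge_path_verts: "edge_path G u es v \<Longrightarrow> u \<in> verts G \<and> v \<in> verts G"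
proof (induction es arbitrary: u)
  case (Cons e es)
  then have "e \<in> arcs G" "u \<in> {tail G e, head G e}" by auto
  then have "u \<in> verts G" by auto
  with Cons show ?case by auto
qed auto

lemma edge_path_arcs: "edge_path G u es v \<Longrightarrow> set es \<subseteq> arcs G"
  by (induction es arbitrary: u) auto

lemma edge_path_append: "edge_path G u es v \<Longrightarrow> edge_path G v fs x \<Longrightarrow> edge_path G u (es @ fs) x"
  by (induction es arbitrary: u) auto

lemma edge_path_head_tail: "e \<in> arcs G \<Longrightarrow> edge_path G (head G e) [e] (tail G e)"
  by auto

lemma edge_path_rev: "edge_path G u es v \<Longrightarrow> edge_path G v (rev es) u"
proof (induction es arbitrary: u)
  case (Cons e es)
  then obtain x where x: "e \<in> arcs G" "{tail G e, head G e} = {u, x}" "edge_path G x es v"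
    by auto
  then have "edge_path G x [e] u"
    using edge_path_verts[of x es v] by (auto simp: doubleton_eq_iff)
  with Cons.IH[OF x(3)] show ?case by (simp add: edge_path_append)
qed auto

text \<open>Cut the path before or after \<open>e\<close>. The ends of an edge decide its Floyd
  length, and this keeps them near the start of the path.\<close>

lemma edge_path_endpoint:
  "edge_path G u es v \<Longrightarrow> e \<in> set es \<Longrightarrow> x \<in> {tail G e, head G e} \<Longrightarrow>
    \<exists>es'. edge_path G u es' x \<and> length es' \<le> length es"
proof (induction es arbitrary: u)
  case (Cons e' es)
  then obtain y where y: "e' \<in> arcs G" "{tail G e', head G e'} = {u, y}" "edge_path G y es v"
    by auto
  have uy: "u \<in> verts G" "y \<in> verts G"
    using edge_path_verts y(3) Cons.prems(1) by blast+
  show ?case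
  proof (cases "e \<in> set es")
    case True
    then obtain es' where "edge_path G y es' x" "length es' \<le> length es"
      using Cons.IH[OF y(3) _ Cons.prems(3)] by blast
    then show ?thesis using y by (intro exI[of _ "e' # es'"]) auto
  next
    case False
    with Cons.prems have "x = u \<or> x = y" using y(2) by auto
    then show ?thesis
    proof
      assume "x = u"
      then show ?thesis using uy by (intro exI[of _ "[]"]) auto
    next
      assume "x = y"
      then show ?thesis using uy y by (intro exI[of _ "[e']"]) auto
    qed
  qed
qed auto

lemma edge_path_exists:
  assumes "Digraph_Component.connected G" "u \<in> verts G" "v \<in> verts G"
  obtains es where "edge_path G u es v"
proof -
  interpret S: pair_wf_digraph "mk_symmetric G" by (rule wellformed_mk_symmetric)
  have "u \<rightarrow>\<^sup>*\<^bsub>mk_symmetric G\<^esub> v"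
    using assms unfolding connected_def strongly_connected_def by simp
  then have "\<exists>es. edge_path G u es v"
  proof (induction rule: S.converse_reachable_induct)
    case base
    then show ?case by (intro exI[of _ "[]"]) simp
  next
    case (step x y)
    then obtain es where es: "edge_path G y es v" by blast
    have "(x, y) \<in> parcs (mk_symmetric G)"
      using step(1) by simp
    then obtain e where "e \<in> arcs G" "{tail G e, head G e} = {x, y}"
      by (auto simp: parcs_mk_symmetric)
    with es have "edge_path G x (e # es) v" by auto
    then show ?case by blast
  qed
  with that show ?thesis by blast
qed

lemma graph_dist_le: "edge_path G u es v \<Longrightarrow> graph_dist G u v \<le> length es"
  unfolding graph_dist_def by (rule cInf_lower) auto

lemma graph_dist_attained:
  assumes "edge_path G u es v"
  obtains es' where "edge_path G u es' v" "length es' = graph_dist G u v"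
proof -
  have "graph_dist G u v \<in> {length es |es. edge_path G u es v}"
    unfolding graph_dist_def using assms by (intro Inf_nat_def1) auto
  with that show ?thesis by auto
qed

end

text \<open>The set whose infimum is \<open>path_metric\<close>, so that the metric axioms can be
  checked route by route.\<close>

definition routes ::
    "('v, 'e) pre_digraph \<Rightarrow> ('e \<Rightarrow> real) \<Rightarrow> ('v, 'e) point \<Rightarrow> ('v, 'e) point \<Rightarrow> real set" where
  "routes G w x y = {\<bar>s - t\<bar> * w e |e s t. x = Inner e s \<and> y = Inner e t} \<union>
             {l + sum_list (map w es) + l' |l l' es u v.
                (u, l) \<in> ends G w x \<and> (v, l') \<in> ends G w y \<and> edge_path G u es v}"

lemma routesE:
  assumes "r \<in> routes G w x y"
  obtains (segment) e s t where "x = Inner e s" "y = Inner e t" "r = \<bar>s - t\<bar> * w e"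
  | (path) l l' es u v where "(u, l) \<in> ends G w x" "(v, l') \<in> ends G w y" "edge_path G u es v"
      "r = l + sum_list (map w es) + l'"
  using assms unfolding routes_def by blast

lemma routes_segment: "\<bar>s - t\<bar> * w e \<in> routes G w (Inner e s) (Inner e t)"
  unfolding routes_def by blast

lemma routes_path:
  "(u, l) \<in> ends G w x \<Longrightarrow> (v, l') \<in> ends G w y \<Longrightarrow> edge_path G u es v \<Longrightarrow>
    l + sum_list (map w es) + l' \<in> routes G w x y"
  unfolding routes_def by blast

lemma Vertex_in_points [simp]: "Vertex v \<in> points G \<longleftrightarrow> v \<in> verts G"
  by (auto simp: points_def)

lemma Inner_in_points [simp]: "Inner e t \<in> points G \<longleftrightarrow> e \<in> arcs G \<and> 0 < t \<and> t < 1"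
  by (auto simp: points_def)

section \<open>Metric axioms for weighted graphs\<close>

locale connected_graph = wf_digraph G for G :: "('v, 'e) pre_digraph" +
  assumes connected: "Digraph_Component.connected G"
    and locally_finite: "locally_finite G"

locale weighted_graph = connected_graph G for G :: "('v, 'e) pre_digraph" +
  fixes w :: "'e \<Rightarrow> real"
  assumes w_pos: "\<And>e. e \<in> arcs G \<Longrightarrow> 0 < w e"
begin

abbreviation dw :: "('v, 'e) point \<Rightarrow> ('v, 'e) point \<Rightarrow> real" where
  "dw \<equiv> path_metric G w"

lemma path_metric_routes:
  "x \<in> points G \<Longrightarrow> y \<in> points G \<Longrightarrow> dw x y = Inf (routes G w x y)"
  by (simp add: path_metric_def routes_def)

lemma ends_nonneg: "x \<in> points G \<Longrightarrow> (u, l) \<in> ends G w x \<Longrightarrow> 0 \<le> l"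
  using w_pos by (cases x) (auto intro!: mult_nonneg_nonneg less_imp_le)

lemma ends_verts: "x \<in> points G \<Longrightarrow> (u, l) \<in> ends G w x \<Longrightarrow> u \<in> verts G"
  by (cases x) auto

lemma ends_nonempty: "\<exists>u l. (u, l) \<in> ends G w x"
  by (cases x) auto

lemma weight_nonneg: "edge_path G u es v \<Longrightarrow> 0 \<le> sum_list (map w es)"
  using edge_path_arcs w_pos by (intro sum_list_nonneg) (fastforce intro: less_imp_le)

lemma routes_nonneg: "x \<in> points G \<Longrightarrow> y \<in> points G \<Longrightarrow> r \<in> routes G w x y \<Longrightarrow> 0 \<le> r"
  using w_pos by (auto elim!: routesE intro!: add_nonneg_nonneg mult_nonneg_nonneg
      intro: ends_nonneg weight_nonneg less_imp_le)

lemma routes_nonempty: "x \<in> points G \<Longrightarrow> y \<in> points G \<Longrightarrow> routes G w x y \<noteq> {}"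
proof -
  assume xy: "x \<in> points G" "y \<in> points G"
  obtain u l v l' where "(u, l) \<in> ends G w x" "(v, l') \<in> ends G w y"
    using ends_nonempty by metis
  moreover from this obtain es where "edge_path G u es v"
    using edge_path_exists[OF connected] ends_verts xy by metis
  ultimately have "l + sum_list (map w es) + l' \<in> routes G w x y" by (intro routes_path)
  then show ?thesis by blast
qed

lemma path_metric_le:
  assumes "x \<in> points G" "y \<in> points G" "r \<in> routes G w x y"
  shows "dw x y \<le> r"
  unfolding path_metric_routes[OF assms(1,2)]
  using assms by (intro cInf_lower bdd_belowI[of _ 0]) (auto intro: routes_nonneg)

lemma path_metric_less:
  assumes "x \<in> points G" "y \<in> points G" "dw x y < c"
  obtains r where "r \<in> routes G w x y" "r < c"
  using cInf_lessD[OF routes_nonempty[OF assms(1,2)]] assms path_metric_routes by metis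

lemma path_metric_greatest:
  assumes "x \<in> points G" "y \<in> points G" "\<And>r. r \<in> routes G w x y \<Longrightarrow> c \<le> r"
  shows "c \<le> dw x y"
  unfolding path_metric_routes[OF assms(1,2)]
  using assms routes_nonempty by (intro cInf_greatest) auto

lemma routes_commute: "r \<in> routes G w x y \<Longrightarrow> r \<in> routes G w y x"
proof (elim routesE)
  fix e s t assume "x = Inner e s" "y = Inner e t" "r = \<bar>s - t\<bar> * w e"
  then show ?thesis using routes_segment[of t s w e G] by (simp add: abs_minus_commute)
next
  fix l l' es u v
  assume "(u, l) \<in> ends G w x" "(v, l') \<in> ends G w y" "edge_path G u es v"
    "r = l + sum_list (map w es) + l'"
  then show ?thesis
    using routes_path[of v l' G w y u l x "rev es"] edge_path_rev
    by (simp add: rev_map[symmetric] add_ac)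
qed

text \<open>Arriving at \<open>y\<close> from one end and leaving to another is replaced by an edge
  path between the ends: the empty one, or the edge carrying \<open>y\<close>, whose weight is then
  \<open>l + l'\<close>.\<close>

lemma ends_connect:
  assumes "y \<in> points G" "(u, l) \<in> ends G w y" "(v, l') \<in> ends G w y"
  obtains es where "edge_path G u es v" "sum_list (map w es) \<le> l + l'"
proof (cases "u = v")
  case True
  then show ?thesis
    using that[of "[]"] ends_verts ends_nonneg assms by (simp add: add_nonneg_nonneg)
next
  case False
  with assms obtain e t where y: "y = Inner e t" "e \<in> arcs G" by (cases y) auto
  have "t * w e + (1 - t) * w e = w e" by (simp add: algebra_simps)
  then have "sum_list (map w [e]) \<le> l + l'"
    using False assms y by auto
  moreover have "edge_path G u [e] v"
    using False assms y by auto
  ultimately show ?thesis using that by blast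
qed

text \<open>Leaving an edge directly is no longer than first moving inside it and leaving by the
  same end.\<close>

lemma ends_segment:
  assumes "Inner e s \<in> points G" "(u, l) \<in> ends G w (Inner e t)"
  obtains l' where "(u, l') \<in> ends G w (Inner e s)" "l' \<le> \<bar>s - t\<bar> * w e + l"
proof -
  have "0 < w e" using assms w_pos by auto
  then have le: "s * w e \<le> (\<bar>s - t\<bar> + t) * w e" "(1 - s) * w e \<le> (\<bar>s - t\<bar> + (1 - t)) * w e"
    by (intro mult_right_mono; simp)+
  have "u = tail G e \<and> l = t * w e \<or> u = head G e \<and> l = (1 - t) * w e"
    using assms(2) by auto
  then show ?thesis
    using that[of "s * w e"] that[of "(1 - s) * w e"] le by (auto simp: distrib_right)
qed

lemma routes_triangle:
  assumes P: "x \<in> points G" "y \<in> points G" "z \<in> points G"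
    and r: "r \<in> routes G w x y" and q: "q \<in> routes G w y z"
  shows "\<exists>p\<in>routes G w x z. p \<le> r + q"
proof -
  \<comment> \<open>Stated for arbitrary points because the opposite order, a path followed by a
    segment, is obtained from it by reversing both routes.\<close>
  have segment_path: "\<exists>p\<in>routes G w x z. p \<le> r + q"
    if "x \<in> points G" "x = Inner e s" "y = Inner e t" "r = \<bar>s - t\<bar> * w e"
      "(u, l) \<in> ends G w y" "(v, l') \<in> ends G w z" "edge_path G u es v" "q = l + sum_list (map w es) + l'"
    for x y z e s t u l v l' es r q
  proof -
    have P': "Inner e s \<in> points G" "(u, l) \<in> ends G w (Inner e t)" "x = Inner e s" "r = \<bar>s - t\<bar> * w e"
      using that by simp_all
    obtain k where "(u, k) \<in> ends G w x" "k \<le> r + l"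
      using ends_segment[of e s u l t] P' by metis
    then show ?thesis
      using routes_path[of u k G w x v l' z es] that by (intro bexI) auto
  qed
  show ?thesis
    using r
  proof (cases rule: routesE)
    case (segment e s t)
    note A = segment
    show ?thesis
      using q
    proof (cases rule: routesE)
      case (segment e' t' s')
      then have e: "e' = e" "t' = t" using A by auto
      have "0 < w e" using A P w_pos by auto
      then have "\<bar>s - s'\<bar> * w e \<le> (\<bar>s - t\<bar> + \<bar>t - s'\<bar>) * w e"
        by (intro mult_right_mono) auto
      then show ?thesis
        using A segment e routes_segment[of s s' w e G]
        by (intro bexI[of _ "\<bar>s - s'\<bar> * w e"]) (auto simp: algebra_simps)
    next
      case (path l l' es u v)
      then show ?thesis using segment_path[OF P(1) A] by blast
    qed
  next
    case (path l l' es u v)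
    note A = path
    show ?thesis
      using q
    proof (cases rule: routesE)
      case (segment e s t)
      have "\<exists>p\<in>routes G w z x. p \<le> q + r"
        using segment_path[of z e t y s q v l' u l x "rev es" r] P(3) segment A edge_path_rev[OF A(3)]
        by (simp add: abs_minus_commute rev_map[symmetric] add_ac)
      then show ?thesis using routes_commute by (metis add.commute)
    next
      case (path k k' fs u' v')
      obtain hs where hs: "edge_path G v hs u'" "sum_list (map w hs) \<le> l' + k"
        using ends_connect[OF P(2) A(2) path(1)] by blast
      have "edge_path G u (es @ hs @ fs) v'"
        using A(3) hs(1) path(3) by (intro edge_path_append)
      from routes_path[OF A(1) path(2) this] show ?thesis
        using A(4) path(4) hs(2) by (intro bexI) auto
    qed
  qed
qed

text \<open>A lower bound for the distance from a point to every other vertex; the 1 covers a vertex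
  without edges, and local finiteness makes the minimum positive. Interior points of edges can be
  arbitrarily near a vertex, so only distances to vertices are bounded.\<close>

fun isolation :: "('v, 'e) point \<Rightarrow> real" where
  "isolation (Vertex v) = Min (insert 1 (w ` (in_arcs G v \<union> out_arcs G v)))"
| "isolation (Inner e t) = min t (1 - t) * w e"

lemma isolation_pos: "x \<in> points G \<Longrightarrow> 0 < isolation x"
  using w_pos locally_finite by (cases x) (auto simp: locally_finite_def)

lemma ends_isolation: "x = Inner e t \<Longrightarrow> x \<in> points G \<Longrightarrow> (u, l) \<in> ends G w x \<Longrightarrow> isolation x \<le> l"
  using w_pos[of e] by (auto intro!: mult_right_mono min.cobounded1 min.cobounded2)

lemma edge_path_isolation:
  assumes "edge_path G u es v" "u \<noteq> v"
  shows "isolation (Vertex u) \<le> sum_list (map w es)"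
proof -
  obtain e fs where es: "es = e # fs" using assms by (cases es) auto
  then obtain y where y: "e \<in> arcs G" "{tail G e, head G e} = {u, y}" "edge_path G y fs v"
    using assms by auto
  then have "e \<in> in_arcs G u \<union> out_arcs G u"
    by (auto simp: doubleton_eq_iff)
  moreover have "finite (in_arcs G u \<union> out_arcs G u)"
    using locally_finite edge_path_verts[OF assms(1)] by (auto simp: locally_finite_def)
  ultimately have "isolation (Vertex u) \<le> w e" by simp
  also have "\<dots> \<le> sum_list (map w es)" using es weight_nonneg[OF y(3)] by simp
  finally show ?thesis .
qed

lemma vertex_route_isolation:
  assumes "x \<in> points G" "x \<noteq> Vertex v" "r \<in> routes G w x (Vertex v)"
  shows "isolation x \<le> r"
  using assms(3)
proof (cases rule: routesE)
  case (path l l' es u v')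
  then have v: "v' = v" "l' = 0" by auto
  show ?thesis
  proof (cases x)
    case (Vertex u')
    then show ?thesis using path assms edge_path_isolation[of u es v] v by auto
  next
    case (Inner e t)
    then show ?thesis
      using ends_isolation[OF Inner assms(1) path(1)] weight_nonneg[OF path(3)] path(4) v by simp
  qed
qed simp

lemma vertex_isolated:
  assumes "x \<in> points G" "v \<in> verts G" "x \<noteq> Vertex v"
  shows "isolation x \<le> dw x (Vertex v)"
  using assms vertex_route_isolation by (intro path_metric_greatest) auto

lemma path_metric_pos:
  assumes "x \<in> points G" "y \<in> points G" "x \<noteq> y"
  shows "0 < dw x y"
proof -
  have path_bound: "min (isolation x) (isolation y) \<le> l + sum_list (map w es) + l'"
    if "(u, l) \<in> ends G w x" "(v, l') \<in> ends G w y" "edge_path G u es v" for l l' es u v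
  proof (cases y)
    case (Vertex v')
    then show ?thesis
      using vertex_route_isolation[of x v'] routes_path[OF that] assms by (auto simp: min_le_iff_disj)
  next
    case (Inner e t)
    have "isolation y \<le> l'" by (rule ends_isolation[OF Inner assms(2) that(2)])
    then show ?thesis
      using weight_nonneg[OF that(3)] ends_nonneg[OF assms(1) that(1)] by simp
  qed
  \<comment> \<open>\<open>m\<close> takes care of the segment inside a common edge; in all other
    cases 1 is a positive default.\<close>
  define m where "m = (case (x, y) of (Inner e s, Inner e' t) \<Rightarrow> if e = e' then \<bar>s - t\<bar> * w e else 1 | _ \<Rightarrow> 1)"
  have "0 < m" using assms w_pos by (auto simp: m_def split: point.split intro!: mult_pos_pos)
  have "Min {m, isolation x, isolation y} \<le> dw x y"
  proof (rule path_metric_greatest[OF assms(1,2)])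
    fix r assume "r \<in> routes G w x y"
    then show "Min {m, isolation x, isolation y} \<le> r"
    proof (cases rule: routesE)
      case (segment e s t)
      then show ?thesis by (auto simp: m_def)
    next
      case (path l l' es u v)
      then show ?thesis using path_bound[OF path(1-3)] by auto
    qed
  qed
  moreover have "0 < Min {m, isolation x, isolation y}"
    using \<open>0 < m\<close> isolation_pos assms by simp
  ultimately show ?thesis by linarith
qed

lemma path_metric_self: "x \<in> points G \<Longrightarrow> dw x x = 0"
proof -
  assume x: "x \<in> points G"
  have "0 \<in> routes G w x x"
  proof (cases x)
    case (Vertex v)
    then show ?thesis using routes_path[of v 0 G w x v 0 x "[]"] x by simp
  next
    case (Inner e t)
    then show ?thesis using routes_segment[of t t w e G] by simp
  qed
  then show ?thesis
    using path_metric_le[OF x x] path_metric_greatest[OF x x, of 0] routes_nonneg[OF x x] by force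
qed

lemma metric: "Metric_space (points G) dw"
proof
  fix x y
  show "0 \<le> dw x y"
    using path_metric_greatest[of x y 0] routes_nonneg[of x y] by (auto simp: path_metric_def)
  have "routes G w x y = routes G w y x" using routes_commute by blast
  then show "dw x y = dw y x"
    by (simp add: path_metric_def routes_def)
next
  fix x y assume "x \<in> points G" "y \<in> points G"
  then show "(dw x y = 0) = (x = y)" using path_metric_pos[of x y] path_metric_self by force
next
  fix x y z assume P: "x \<in> points G" "y \<in> points G" "z \<in> points G"
  show "dw x z \<le> dw x y + dw y z"
  proof (rule field_le_epsilon)
    fix e :: real assume "0 < e"
    then obtain r q where "r \<in> routes G w x y" "r < dw x y + e / 2" "q \<in> routes G w y z" "q < dw y z + e / 2"
      using path_metric_less[OF P(1,2)] path_metric_less[OF P(2,3)]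
      by (metis half_gt_zero less_add_same_cancel1)
    moreover from this obtain p where "p \<in> routes G w x z" "p \<le> r + q"
      using routes_triangle[OF P] by blast
    ultimately show "dw x z \<le> dw x y + dw y z + e"
      using path_metric_le[OF P(1,3)] by fastforce
  qed
qed

lemma path_metric_edge_path: "edge_path G u es v \<Longrightarrow> dw (Vertex u) (Vertex v) \<le> sum_list (map w es)"
  using routes_path[of u 0 G w "Vertex u" v 0 "Vertex v" es] edge_path_verts
  by (intro path_metric_le) auto

end

section \<open>Floyd functions\<close>

lemma floyd_function_pos: "floyd_function f \<Longrightarrow> 0 < f (max 1 n)"
  by (simp add: floyd_function_def)

lemma floyd_function_antimono:
  assumes "floyd_function f" "m \<le> n"
  shows "f (max 1 n) \<le> f (max 1 m)"
proof -
  have "f (Suc n) \<le> f n" if "1 \<le> n" for n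
  proof -
    have "1 \<le> f n / f (n + 1)" "0 < f (n + 1)"
      using assms(1) that unfolding floyd_function_def by auto
    then show ?thesis by (simp add: field_simps)
  qed
  then have "f (max 1 (Suc n)) \<le> f (max 1 n)" for n
    by (cases n) auto
  then show ?thesis using \<open>m \<le> n\<close> by (rule lift_Suc_antimono_le)
qed

lemma floyd_function_summable:
  assumes "floyd_function f"
  shows "summable (\<lambda>n. f (max 1 n))"
  using assms summable_Suc_iff[of "\<lambda>n. f (max 1 n)"] by (simp add: floyd_function_def)

lemma floyd_function_tendsto_0:
  assumes "floyd_function f"
  shows "(\<lambda>n. f (max 1 n)) \<longlonglongrightarrow> 0"
  using floyd_function_summable[OF assms] by (rule summable_LIMSEQ_zero)

text \<open>\<open>T\<close> is the tail integral of the step function with value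
  \<open>f (max 1 n)\<close> on the interval from \<open>n\<close> to \<open>n + 1\<close>: the sum
  of the series minus the integral from 0, which is linear between integers.\<close>

lemma floyd_function_tail:
  assumes f: "floyd_function f"
  obtains T :: "real \<Rightarrow> real"
    where "\<And>r s. 0 \<le> r \<Longrightarrow> r \<le> s \<Longrightarrow> (s - r) * f (max 1 (nat \<lfloor>s\<rfloor>)) \<le> T r - T s" "(T \<longlongrightarrow> 0) at_top"
proof -
  define g where "g n = f (max 1 n)" for n
  define F where "F n = (\<Sum>i<n. g i)" for n
  define T where "T x = suminf g - (F (nat \<lfloor>x\<rfloor>) + (x - real (nat \<lfloor>x\<rfloor>)) * g (nat \<lfloor>x\<rfloor>))" for x
  have g_anti: "g n \<le> g m" if "m \<le> n" for m n
    using floyd_function_antimono[OF f that] by (simp add: g_def)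
  have g_pos: "0 < g n" for n using floyd_function_pos[OF f] by (simp add: g_def)
  have F_diff: "real (n - m) * g n \<le> F n - F m" if "m \<le> n" for m n
  proof -
    have "F n - F m = sum g {m..<n}"
      unfolding F_def using sum_diff_nat_ivl[of 0 m n g] that by (simp add: atLeast0LessThan)
    moreover have "(\<Sum>i\<in>{m..<n}. g n) \<le> sum g {m..<n}"
      by (intro sum_mono g_anti) auto
    ultimately show ?thesis by simp
  qed
  have 1: "(s - r) * g (nat \<lfloor>s\<rfloor>) \<le> T r - T s" if "0 \<le> r" "r \<le> s" for r s
  proof -
    define m n where "m = nat \<lfloor>r\<rfloor>" and "n = nat \<lfloor>s\<rfloor>"
    have m: "real m \<le> r" "r < real m + 1" and n: "real n \<le> s" "s < real n + 1" and "m \<le> n"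
      using that by (auto simp: m_def n_def nat_mono floor_mono)
    have "(s - r) * g n \<le> F n + (s - real n) * g n - (F m + (r - real m) * g m)"
    proof (cases "m = n")
      case True
      then show ?thesis by (simp add: algebra_simps)
    next
      case False
      with \<open>m \<le> n\<close> have "Suc m \<le> n" by simp
      \<comment> \<open>The interval from \<open>r\<close> to \<open>s\<close> is split into the
        rest of the cell of \<open>r\<close>, the full cells, and the beginning of the cell of
        \<open>s\<close>.\<close>
      have "(real m + 1 - r) * g n \<le> (real m + 1 - r) * g m"
        using m g_anti[OF \<open>m \<le> n\<close>] by (intro mult_left_mono) auto
      moreover have "(real n - real m - 1) * g n \<le> F n - F m - g m"
        using F_diff[OF \<open>Suc m \<le> n\<close>] \<open>Suc m \<le> n\<close> by (simp add: F_def of_nat_diff algebra_simps)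
      ultimately show ?thesis by (simp add: algebra_simps)
    qed
    then show ?thesis by (simp add: T_def m_def n_def)
  qed
  have summ: "summable g" using floyd_function_summable[OF f] by (simp add: g_def[abs_def])
  have "(\<lambda>n. suminf g - F n) \<longlonglongrightarrow> suminf g - suminf g"
    unfolding F_def by (intro tendsto_intros summable_LIMSEQ summ)
  then have F0: "(\<lambda>n. suminf g - F n) \<longlonglongrightarrow> 0" by simp
  have lim: "filterlim (\<lambda>x::real. nat \<lfloor>x\<rfloor>) at_top at_top"
    by (intro filterlim_compose[OF filterlim_nat_sequentially] filterlim_floor_sequentially)
  have bounds: "eventually (\<lambda>x::real. suminf g - F (Suc (nat \<lfloor>x\<rfloor>)) \<le> T x \<and> T x \<le> suminf g - F (nat \<lfloor>x\<rfloor>)) at_top"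
    using eventually_ge_at_top[of 0]
  proof (rule eventually_mono)
    fix x :: real assume "0 \<le> x"
    define n where "n = nat \<lfloor>x\<rfloor>"
    have n: "real n \<le> x" "x - real n \<le> 1" using \<open>0 \<le> x\<close> by (auto simp: n_def) linarith
    then have "0 \<le> (x - real n) * g n" "(x - real n) * g n \<le> 1 * g n"
      using g_pos[of n] by (auto intro: mult_right_mono)
    then show "suminf g - F (Suc (nat \<lfloor>x\<rfloor>)) \<le> T x \<and> T x \<le> suminf g - F (nat \<lfloor>x\<rfloor>)"
      by (simp add: T_def F_def n_def)
  qed
  have "(T \<longlongrightarrow> 0) at_top"
  proof (rule tendsto_sandwich)
    show "((\<lambda>x::real. suminf g - F (Suc (nat \<lfloor>x\<rfloor>))) \<longlongrightarrow> 0) at_top"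
      using filterlim_compose[OF LIMSEQ_Suc[OF F0] lim] .
    show "((\<lambda>x::real. suminf g - F (nat \<lfloor>x\<rfloor>)) \<longlongrightarrow> 0) at_top"
      using filterlim_compose[OF F0 lim] .
  qed (use bounds in \<open>auto elim: eventually_mono\<close>)
  with 1 show ?thesis using that[of T] by (simp add: g_def)
qed

section \<open>Comparison of the Floyd distance with the path distance\<close>

lemma (in connected_graph) graph_dist_geodesic:
  assumes "u \<in> verts G" "v \<in> verts G"
  obtains es where "edge_path G u es v" "length es = graph_dist G u v"
  using edge_path_exists[OF connected assms] graph_dist_attained by metis

locale floyd_graph = connected_graph G for G :: "('v, 'e) pre_digraph" +
  fixes b :: 'v and f :: "nat \<Rightarrow> real"
  assumes b: "b \<in> verts G" and f: "floyd_function f"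
begin

abbreviation d1 :: "('v, 'e) point \<Rightarrow> ('v, 'e) point \<Rightarrow> real" where
  "d1 \<equiv> path_metric G (\<lambda>_. 1)"

abbreviation df :: "('v, 'e) point \<Rightarrow> ('v, 'e) point \<Rightarrow> real" where
  "df \<equiv> path_metric G (floyd_length G b f)"

sublocale U: weighted_graph G "\<lambda>_. 1"
  by unfold_locales simp

sublocale W: weighted_graph G "floyd_length G b f"
  by unfold_locales (unfold floyd_length_def, rule floyd_function_pos[OF f])

sublocale D: Metric_space "points G" d1 by (rule U.metric)
sublocale F: Metric_space "points G" df by (rule W.metric)

lemma sum_list_1: "sum_list (map (\<lambda>_. 1) es) = real (length es)"
  by (simp add: sum_list_triv)

lemma unit_dist_le: "edge_path G u es v \<Longrightarrow> d1 (Vertex u) (Vertex v) \<le> length es"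
  using U.path_metric_edge_path[of u es v] by (simp add: sum_list_1)

lemma unit_dist_vertices:
  assumes "u \<in> verts G" "v \<in> verts G"
  shows "d1 (Vertex u) (Vertex v) = graph_dist G u v"
proof (rule antisym)
  show "d1 (Vertex u) (Vertex v) \<le> graph_dist G u v"
    using graph_dist_geodesic[OF assms] unit_dist_le by metis
  show "graph_dist G u v \<le> d1 (Vertex u) (Vertex v)"
  proof (rule U.path_metric_greatest)
    fix r assume "r \<in> routes G (\<lambda>_. 1) (Vertex u) (Vertex v)"
    then show "graph_dist G u v \<le> r"
      using graph_dist_le by (cases rule: routesE) (auto simp: sum_list_1)
  qed (use assms in auto)
qed

lemma floyd_length_le:
  assumes "e \<in> arcs G" "h \<le> d1 (Vertex b) (Vertex (tail G e))" "h \<le> d1 (Vertex b) (Vertex (head G e))"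
  shows "floyd_length G b f e \<le> f (max 1 (nat \<lfloor>h\<rfloor>))"
proof -
  have "nat \<lfloor>h\<rfloor> \<le> graph_dist G b (tail G e)" "nat \<lfloor>h\<rfloor> \<le> graph_dist G b (head G e)"
    using assms b by (auto simp: unit_dist_vertices nat_le_iff) linarith+
  then show ?thesis
    unfolding floyd_length_def by (intro floyd_function_antimono[OF f]) auto
qed

lemma ends_scale:
  assumes "x \<in> points G" "(u, l) \<in> ends G (\<lambda>_. 1) x" "\<And>e t. x = Inner e t \<Longrightarrow> w e \<le> c"
  obtains l' where "(u, l') \<in> ends G w x" "l' \<le> c * l"
proof (cases x)
  case (Vertex v)
  then show ?thesis using that[of 0] assms by auto
next
  case (Inner e t)
  have "w e \<le> c" "0 < t" "t < 1" using assms Inner by auto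
  then have "t * w e \<le> c * t" "(1 - t) * w e \<le> c * (1 - t)"
    by (auto simp: mult.commute[of c] intro!: mult_left_mono)
  then show ?thesis using that[of "t * w e"] that[of "(1 - t) * w e"] assms(2) Inner by auto
qed

lemma inner_near_ends:
  assumes "Inner e t \<in> points G"
  shows "d1 (Inner e t) (Vertex (tail G e)) \<le> 1" "d1 (Inner e t) (Vertex (head G e)) \<le> 1"
proof -
  have "t \<in> routes G (\<lambda>_. 1) (Inner e t) (Vertex (tail G e))"
    "1 - t \<in> routes G (\<lambda>_. 1) (Inner e t) (Vertex (head G e))"
    using routes_path[of "tail G e" t G "\<lambda>_. 1" "Inner e t" "tail G e" 0 "Vertex (tail G e)" "[]"]
      routes_path[of "head G e" "1 - t" G "\<lambda>_. 1" "Inner e t" "head G e" 0 "Vertex (head G e)" "[]"]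
      assms by auto
  then show "d1 (Inner e t) (Vertex (tail G e)) \<le> 1" "d1 (Inner e t) (Vertex (head G e)) \<le> 1"
    using assms by (auto dest!: U.path_metric_le[rotated 2])
qed

text \<open>Each edge met by the route has both ends within \<open>r + 1\<close> of
  \<open>x\<close>, the extra 1 being for edges of which only a part is used. Hence all their Floyd
  lengths are bounded by the same value, and the same route can be measured with the Floyd
  weights.\<close>

lemma floyd_dist_route:
  assumes x: "x \<in> points G" and y: "y \<in> points G" and r: "r \<in> routes G (\<lambda>_. 1) x y"
  shows "df x y \<le> r * f (max 1 (nat \<lfloor>d1 (Vertex b) x - r - 1\<rfloor>))"
proof -
  define h where "h = d1 (Vertex b) x - r - 1"
  define c where "c = f (max 1 (nat \<lfloor>h\<rfloor>))"
  have "0 \<le> r" using U.routes_nonneg[OF x y r] .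
  have near: "h \<le> d1 (Vertex b) (Vertex v)" if "v \<in> verts G" "d1 x (Vertex v) \<le> r + 1" for v
    using D.triangle[of "Vertex b" "Vertex v" x] b x that by (simp add: h_def D.commute)
  have edge: "floyd_length G b f e \<le> c"
    if "e \<in> arcs G" "\<And>v. v \<in> {tail G e, head G e} \<Longrightarrow> d1 x (Vertex v) \<le> r + 1" for e
    unfolding c_def using that by (intro floyd_length_le near) auto
  have x_edge: "floyd_length G b f e \<le> c" if "x = Inner e t" for e t
    using that x \<open>0 \<le> r\<close> inner_near_ends[of e t] by (intro edge) auto
  have dxy: "d1 x y \<le> r" by (rule U.path_metric_le[OF x y r])
  have y_edge: "floyd_length G b f e \<le> c" if "y = Inner e t" for e t
  proof (rule edge)
    show "e \<in> arcs G" using that y by auto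
    fix v assume "v \<in> {tail G e, head G e}"
    then have "d1 y (Vertex v) \<le> 1" "v \<in> verts G"
      using inner_near_ends[of e t] that y by auto
    then show "d1 x (Vertex v) \<le> r + 1"
      using D.triangle[OF x y, of "Vertex v"] dxy by auto
  qed
  have "\<exists>r'\<in>routes G (floyd_length G b f) x y. r' \<le> c * r"
    using r
  proof (cases rule: routesE)
    case (segment e s t)
    then show ?thesis
      using x_edge[of e s] routes_segment[of s t "floyd_length G b f" e G]
      by (intro bexI) (auto simp: mult.commute[of c] intro: mult_left_mono)
  next
    case (path l l' es u v)
    obtain k where k: "(u, k) \<in> ends G (floyd_length G b f) x" "k \<le> c * l"
      using ends_scale[OF x path(1), of "floyd_length G b f" c] x_edge by blast
    obtain k' where k': "(v, k') \<in> ends G (floyd_length G b f) y" "k' \<le> c * l'"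
      using ends_scale[OF y path(2), of "floyd_length G b f" c] y_edge by blast
    have l: "0 \<le> l" "0 \<le> l'"
      using U.ends_nonneg x y path by blast+
    have "floyd_length G b f e \<le> c" if e: "e \<in> set es" for e
    proof (rule edge)
      show "e \<in> arcs G" using edge_path_arcs[OF path(3)] e by auto
      fix z assume "z \<in> {tail G e, head G e}"
      then obtain fs where fs: "edge_path G u fs z" "length fs \<le> length es"
        using edge_path_endpoint[OF path(3) e] by blast
      have "d1 x (Vertex z) \<le> l + real (length fs) + 0"
        using U.path_metric_le[OF x] routes_path[OF path(1) _ fs(1), of 0 "Vertex z"] edge_path_verts[OF fs(1)]
        by (simp add: sum_list_1)
      then show "d1 x (Vertex z) \<le> r + 1"
        using fs(2) path(4) l by (simp add: sum_list_1)
    qed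
    then have "sum_list (map (floyd_length G b f) es) \<le> sum_list (map (\<lambda>_. c) es)"
      by (intro sum_list_mono)
    also have "\<dots> = c * length es" by (simp add: sum_list_triv)
    finally show ?thesis
      using routes_path[OF k(1) k'(1) path(3)] k(2) k'(2) path(4)
      by (intro bexI) (auto simp: sum_list_1 algebra_simps)
  qed
  then show ?thesis
    using W.path_metric_le[OF x y] unfolding c_def h_def by (metis mult.commute order_trans)
qed

lemma floyd_dist_le:
  assumes x: "x \<in> points G" and y: "y \<in> points G"
  shows "df x y \<le> d1 x y * f (max 1 (nat \<lfloor>d1 (Vertex b) x - d1 x y - 2\<rfloor>))"
proof -
  define c where "c = f (max 1 (nat \<lfloor>d1 (Vertex b) x - d1 x y - 2\<rfloor>))"
  have "0 < c" using floyd_function_pos[OF f] by (simp add: c_def)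
  have "df x y \<le> d1 x y * c + e" if "0 < e" for e
  proof -
    \<comment> \<open>The bound 1 turns the loss of 1 for a route into the loss of 2 claimed here;
      the bound \<open>e / c\<close> becomes the error \<open>e\<close> after multiplication by
      \<open>c\<close>.\<close>
    have "0 < min 1 (e / c)" using that \<open>0 < c\<close> by simp
    then obtain r where r: "r \<in> routes G (\<lambda>_. 1) x y" "r < d1 x y + min 1 (e / c)"
      using U.path_metric_less[OF x y, of "d1 x y + min 1 (e / c)"] by auto
    have "df x y \<le> r * f (max 1 (nat \<lfloor>d1 (Vertex b) x - r - 1\<rfloor>))"
      by (rule floyd_dist_route[OF x y r(1)])
    also have "\<dots> \<le> r * c"
      using U.routes_nonneg[OF x y r(1)] r(2) unfolding c_def
      by (intro mult_left_mono floyd_function_antimono[OF f] nat_mono floor_mono) auto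
    also have "\<dots> \<le> (d1 x y + e / c) * c"
      using r(2) \<open>0 < c\<close> by (intro mult_right_mono) auto
    also have "\<dots> = d1 x y * c + e"
      using \<open>0 < c\<close> by (simp add: field_simps)
    finally show ?thesis .
  qed
  then show ?thesis unfolding c_def by (rule field_le_epsilon)
qed

text \<open>Stated for vertices and graph distances, since a far point is Floyd close to an end of
  its edge and since this form can be carried over to another graph with the same vertices.\<close>

definition small_at_infinity :: bool where
  "small_at_infinity \<longleftrightarrow> (\<forall>e>0. \<exists>N. \<forall>u\<in>verts G. \<forall>v\<in>verts G.
     N \<le> graph_dist G b u \<longrightarrow> N \<le> graph_dist G b v \<longrightarrow> df (Vertex u) (Vertex v) < e)"

lemma thick_small_at_infinity:
  assumes "thick (points G) d1"
  shows small_at_infinity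
proof -
  obtain k C where "0 < C" "thick_at_most k (points G) d1 C"
    using assms unfolding thick_def thick_of_order_def by blast
  obtain T where T: "\<And>r s. 0 \<le> r \<Longrightarrow> r \<le> s \<Longrightarrow> (s - r) * f (max 1 (nat \<lfloor>s\<rfloor>)) \<le> T r - T s" "(T \<longlongrightarrow> 0) at_top"
    using floyd_function_tail[OF f] by blast
  interpret conformal_metrics "points G" d1 df "Vertex b" "\<lambda>x. f (max 1 (nat \<lfloor>x\<rfloor>))" T
  proof
    show "f (max 1 (nat \<lfloor>y\<rfloor>)) \<le> f (max 1 (nat \<lfloor>x\<rfloor>))" if "x \<le> y" for x y :: real
      using that by (intro floyd_function_antimono[OF f] nat_mono floor_mono)
  qed (use W.metric b floyd_function_pos[OF f] T floyd_dist_le in \<open>auto intro: less_imp_le\<close>)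
  have c: "close (points G) (points G)"
    using thick_close[OF \<open>0 < C\<close> order_refl \<open>thick_at_most k (points G) d1 C\<close>] .
  show ?thesis
    unfolding small_at_infinity_def
  proof (intro allI impI)
    fix e :: real assume "0 < e"
    then obtain R where R: "\<And>x y. x \<in> points G \<Longrightarrow> y \<in> points G \<Longrightarrow> R \<le> d1 (Vertex b) x \<Longrightarrow> R \<le> d1 (Vertex b) y \<Longrightarrow> df x y < e"
      using closeE[OF c] by metis
    have "df (Vertex u) (Vertex v) < e"
      if "u \<in> verts G" "v \<in> verts G" "nat \<lceil>R\<rceil> \<le> graph_dist G b u" "nat \<lceil>R\<rceil> \<le> graph_dist G b v" for u v
      using that b by (intro R) (auto simp: unit_dist_vertices nat_le_iff ceiling_le_iff)
    then show "\<exists>N. \<forall>u\<in>verts G. \<forall>v\<in>verts G. N \<le> graph_dist G b u \<longrightarrow> N \<le> graph_dist G b v \<longrightarrow>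
        df (Vertex u) (Vertex v) < e"
      by blast
  qed
qed

end

section \<open>The boundary\<close>

lemma (in Metric_space) equiv_cauchy_rel: "equiv {\<sigma>. MCauchy \<sigma>} (cauchy_rel M d)"
proof (rule equivI)
  show "cauchy_rel M d \<subseteq> {\<sigma>. MCauchy \<sigma>} \<times> {\<sigma>. MCauchy \<sigma>}"
    by (auto simp: cauchy_rel_def)
  show "refl_on {\<sigma>. MCauchy \<sigma>} (cauchy_rel M d)"
  proof (rule refl_onI)
    fix \<sigma> assume "\<sigma> \<in> {\<sigma>. MCauchy \<sigma>}"
    then have "MCauchy \<sigma>" "range \<sigma> \<subseteq> M" by (auto simp: MCauchy_def)
    then show "(\<sigma>, \<sigma>) \<in> cauchy_rel M d"
      by (auto simp: cauchy_rel_def image_subset_iff)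
  qed
  show "sym (cauchy_rel M d)"
    by (rule symI) (auto simp: cauchy_rel_def commute)
  show "trans (cauchy_rel M d)"
  proof (rule transI)
    fix \<rho> \<sigma> \<tau> assume 1: "(\<rho>, \<sigma>) \<in> cauchy_rel M d" and 2: "(\<sigma>, \<tau>) \<in> cauchy_rel M d"
    have "(\<lambda>n. d (\<rho> n) (\<tau> n)) \<longlonglongrightarrow> 0"
    proof (rule tendsto_sandwich[where f = "\<lambda>_. 0"])
      show "(\<lambda>n. d (\<rho> n) (\<sigma> n) + d (\<sigma> n) (\<tau> n)) \<longlonglongrightarrow> 0"
        using 1 2 tendsto_add[of "\<lambda>n. d (\<rho> n) (\<sigma> n)" 0 sequentially] by (auto simp: cauchy_rel_def)
      show "\<forall>\<^sub>F n in sequentially. d (\<rho> n) (\<tau> n) \<le> d (\<rho> n) (\<sigma> n) + d (\<sigma> n) (\<tau> n)"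
        using 1 2 by (intro always_eventually allI triangle) (auto simp: cauchy_rel_def MCauchy_def)
    qed auto
    then show "(\<rho>, \<tau>) \<in> cauchy_rel M d" using 1 2 by (simp add: cauchy_rel_def)
  qed
qed

lemma (in connected_graph) finite_graph_ball:
  assumes b: "b \<in> verts G"
  shows "finite {v \<in> verts G. graph_dist G b v \<le> N}"
proof (induction N)
  case 0
  have "v = b" if v: "v \<in> verts G" "graph_dist G b v \<le> 0" for v
  proof -
    obtain es where "edge_path G b es v" "length es = graph_dist G b v"
      using graph_dist_geodesic[OF b v(1)] by metis
    with v show ?thesis by simp
  qed
  then have "{v \<in> verts G. graph_dist G b v \<le> 0} \<subseteq> {b}" by blast
  then show ?case by (rule finite_subset) simp
next
  case (Suc N)
  let ?V = "{v \<in> verts G. graph_dist G b v \<le> N}"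
  let ?star = "\<lambda>x. \<Union>e \<in> in_arcs G x \<union> out_arcs G x. {tail G e, head G e}"
  have "v \<in> ?V \<union> (\<Union>x \<in> ?V. ?star x)" if v: "v \<in> verts G" "graph_dist G b v \<le> Suc N" for v
  proof -
    obtain es where es: "edge_path G b es v" "length es = graph_dist G b v"
      using graph_dist_geodesic[OF b v(1)] by metis
    show ?thesis
    proof (cases "rev es")
      case Nil
      then show ?thesis using es v by auto
    next
      case (Cons e fs)
      then obtain x where x: "e \<in> arcs G" "{tail G e, head G e} = {v, x}" "edge_path G x fs b"
        using edge_path_rev[OF es(1)] by auto
      have "length fs \<le> N" using Cons es(2) v(2) by (metis Suc_le_mono length_Cons length_rev)
      then have "graph_dist G b x \<le> N"
        using graph_dist_le[OF edge_path_rev[OF x(3)]] by simp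
      then have "x \<in> ?V" using edge_path_verts[OF x(3)] by simp
      moreover have "e \<in> in_arcs G x \<union> out_arcs G x" "v \<in> {tail G e, head G e}"
        using x by (auto simp: doubleton_eq_iff)
      ultimately show ?thesis by blast
    qed
  qed
  then have "{v \<in> verts G. graph_dist G b v \<le> Suc N} \<subseteq> ?V \<union> (\<Union>x \<in> ?V. ?star x)"
    by blast
  moreover have "finite (?V \<union> (\<Union>x \<in> ?V. ?star x))"
    using Suc locally_finite unfolding locally_finite_def by auto
  ultimately show ?case by (rule finite_subset)
qed

fun anchor :: "('v, 'e) pre_digraph \<Rightarrow> ('v, 'e) point \<Rightarrow> 'v" where
  "anchor G (Vertex v) = v"
| "anchor G (Inner e t) = tail G e"

text \<open>Parametrization of the closed edge, so that a limit of interior points is a point even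
  when the parameter tends to 0 or 1.\<close>

fun edge_point :: "('v, 'e) pre_digraph \<Rightarrow> 'e \<Rightarrow> real \<Rightarrow> ('v, 'e) point" where
  "edge_point G e t = (if t = 0 then Vertex (tail G e) else if t = 1 then Vertex (head G e) else Inner e t)"

lemma (in weighted_graph) edge_point_dist:
  assumes "e \<in> arcs G" "0 < s" "s < 1" "0 \<le> t" "t \<le> 1"
  shows "path_metric G w (Inner e s) (edge_point G e t) \<le> \<bar>s - t\<bar> * w e"
proof (rule path_metric_le)
  show "\<bar>s - t\<bar> * w e \<in> routes G w (Inner e s) (edge_point G e t)"
    using routes_path[of "tail G e" "s * w e" G w "Inner e s" "tail G e" 0 "Vertex (tail G e)" "[]"]
      routes_path[of "head G e" "(1 - s) * w e" G w "Inner e s" "head G e" 0 "Vertex (head G e)" "[]"]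
      routes_segment[of s t w e G] assms by auto
qed (use assms in auto)

section \<open>Cauchy sequences that converge in the graph and those that leave every ball\<close>

context floyd_graph
begin

lemma anchor_verts: "x \<in> points G \<Longrightarrow> anchor G x \<in> verts G"
  by (cases x) auto

text \<open>By local finiteness infinitely many terms sit at one vertex or in one edge. A closed
  edge is compact, and a Cauchy sequence with a convergent subsequence converges.\<close>

lemma bounded_frequently_convergent:
  assumes \<tau>: "F.MCauchy \<tau>" and "infinite {n. graph_dist G b (anchor G (\<tau> n)) \<le> N}"
  obtains x where "x \<in> points G" "(\<lambda>n. df (\<tau> n) x) \<longlonglongrightarrow> 0"
proof -
  have P: "\<tau> n \<in> points G" for n using \<tau> by (auto simp: F.MCauchy_def)
  define kind :: "('v, 'e) point \<Rightarrow> 'v + 'e" where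
    "kind x = (case x of Vertex v \<Rightarrow> Inl v | Inner e t \<Rightarrow> Inr e)" for x
  let ?A = "{n. graph_dist G b (anchor G (\<tau> n)) \<le> N}"
  let ?V = "{v \<in> verts G. graph_dist G b v \<le> N}"
  have "kind (\<tau> n) \<in> Inl ` ?V \<union> Inr ` (\<Union>v \<in> ?V. out_arcs G v)" if "n \<in> ?A" for n
    using that P[of n] by (cases "\<tau> n") (auto simp: kind_def)
  then have "(\<lambda>n. kind (\<tau> n)) ` ?A \<subseteq> Inl ` ?V \<union> Inr ` (\<Union>v \<in> ?V. out_arcs G v)"
    by blast
  moreover have "finite (Inl ` ?V \<union> Inr ` (\<Union>v \<in> ?V. out_arcs G v))"
    using finite_graph_ball[OF b, of N] locally_finite unfolding locally_finite_def by auto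
  ultimately have "finite ((\<lambda>n. kind (\<tau> n)) ` ?A)"
    by (rule finite_subset)
  then obtain n0 where "infinite {n \<in> ?A. kind (\<tau> n) = kind (\<tau> n0)}"
    using pigeonhole_infinite[OF assms(2)] by blast
  then obtain r :: "nat \<Rightarrow> nat" where r: "strict_mono r" "\<And>n. kind (\<tau> (r n)) = kind (\<tau> n0)"
    using infinite_enumerate by (metis (mono_tags, lifting) mem_Collect_eq)
  have "\<exists>q x. strict_mono q \<and> x \<in> points G \<and> (\<lambda>n. df (\<tau> (q n)) x) \<longlonglongrightarrow> 0"
  proof (cases "\<tau> n0")
    case (Vertex v)
    have "\<tau> (r n) = Vertex v" for n
      using r(2)[of n] Vertex by (simp add: kind_def split: point.splits)
    then have "\<And>n. df (\<tau> (r n)) (Vertex v) = 0" "Vertex v \<in> points G"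
      using P[of n0] Vertex F.mdist_zero by auto
    then show ?thesis using r(1) by (intro exI[of _ r] exI[of _ "Vertex v"]) simp
  next
    case (Inner e t0)
    have "\<exists>t. \<tau> (r n) = Inner e t" for n
      using r(2)[of n] Inner by (simp add: kind_def split: point.splits)
    then obtain t where t: "\<And>n. \<tau> (r n) = Inner e (t n)" by metis
    have e: "e \<in> arcs G" "0 < t n" "t n < 1" for n
      using P[of "r n"] t[of n] by auto
    have "seq_compact {0..1::real}" by (simp add: compact_imp_seq_compact)
    moreover have "\<forall>n. t n \<in> {0..1}" using e by (simp add: less_imp_le)
    ultimately obtain l q where l: "l \<in> {0..1}" and q: "strict_mono q" "(t \<circ> q) \<longlonglongrightarrow> l"
      unfolding seq_compact_def by metis
    let ?x = "edge_point G e l"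
    have x: "?x \<in> points G" using e l by auto
    have "(\<lambda>n. df (\<tau> (r (q n))) ?x) \<longlonglongrightarrow> 0"
    proof (rule tendsto_sandwich[where f = "\<lambda>_. 0"])
      have "(\<lambda>n. \<bar>t (q n) - l\<bar> * floyd_length G b f e) \<longlonglongrightarrow> \<bar>l - l\<bar> * floyd_length G b f e"
        using q(2) unfolding o_def by (intro tendsto_intros)
      then show "(\<lambda>n. \<bar>t (q n) - l\<bar> * floyd_length G b f e) \<longlonglongrightarrow> 0" by simp
      show "\<forall>\<^sub>F n in sequentially. df (\<tau> (r (q n))) ?x \<le> \<bar>t (q n) - l\<bar> * floyd_length G b f e"
        unfolding t using W.edge_point_dist e l by (intro always_eventually allI) auto
    qed auto
    then show ?thesis
      using x strict_mono_o[OF r(1) q(1)] by (intro exI[of _ "r \<circ> q"] exI[of _ ?x]) simp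
  qed
  then obtain q x where q: "strict_mono q" "x \<in> points G" "(\<lambda>n. df (\<tau> (q n)) x) \<longlonglongrightarrow> 0"
    by blast
  then have "limitin F.mtopology (\<tau> \<circ> q) x sequentially"
    unfolding F.limitin_metric_dist_null using P by simp
  then have "limitin F.mtopology \<tau> x sequentially"
    by (rule F.MCauchy_convergent_subsequence[OF \<tau> q(1)])
  then have "(\<lambda>n. df (\<tau> n) x) \<longlonglongrightarrow> 0"
    unfolding F.limitin_metric_dist_null by blast
  with q(2) that show ?thesis by blast
qed

lemma convergent_class:
  assumes "F.MCauchy \<tau>" "x \<in> points G" "(\<lambda>n. df (\<tau> n) x) \<longlonglongrightarrow> 0"
  shows "cauchy_rel (points G) df `` {\<tau>} = completion_embedding (points G) df x"
proof -
  have "(\<tau>, \<lambda>_. x) \<in> cauchy_rel (points G) df"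
    using assms by (simp add: cauchy_rel_def)
  then show ?thesis
    unfolding completion_embedding_def by (rule equiv_class_eq[OF F.equiv_cauchy_rel])
qed

text \<open>A representative that returned infinitely often to a ball would converge to a point of
  the graph, and its class would be an embedded point.\<close>

lemma boundary_class:
  assumes "X \<in> floyd_boundary G b f"
  obtains \<tau> where "X = cauchy_rel (points G) df `` {\<tau>}" "F.MCauchy \<tau>"
    "\<And>N. eventually (\<lambda>n. N < graph_dist G b (anchor G (\<tau> n))) sequentially"
proof -
  obtain \<tau> where \<tau>: "X = cauchy_rel (points G) df `` {\<tau>}" "F.MCauchy \<tau>"
    and not: "X \<notin> completion_embedding (points G) df ` points G"
    using assms unfolding floyd_boundary_def Let_def cauchy_completion_def by (auto elim!: quotientE)
  have "eventually (\<lambda>n. N < graph_dist G b (anchor G (\<tau> n))) sequentially" for N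
  proof (rule ccontr)
    assume "\<not> ?thesis"
    then have "infinite {n. graph_dist G b (anchor G (\<tau> n)) \<le> N}"
      unfolding cofinite_eq_sequentially[symmetric] eventually_cofinite by (simp add: not_less)
    then obtain x where "x \<in> points G" "(\<lambda>n. df (\<tau> n) x) \<longlonglongrightarrow> 0"
      using bounded_frequently_convergent[OF \<tau>(2)] by blast
    then show False using convergent_class[OF \<tau>(2)] \<tau>(1) not by blast
  qed
  with \<tau> that show ?thesis by blast
qed

lemma floyd_boundary_finite_graph:
  assumes "finite (verts G)"
  shows "floyd_boundary G b f = {}"
proof (rule ccontr)
  assume "floyd_boundary G b f \<noteq> {}"
  then obtain X where "X \<in> floyd_boundary G b f" by blast
  then obtain \<tau> where \<tau>: "F.MCauchy \<tau>"
    "\<And>N. eventually (\<lambda>n. N < graph_dist G b (anchor G (\<tau> n))) sequentially"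
    using boundary_class by metis
  have le: "graph_dist G b v \<le> Max (graph_dist G b ` verts G)" if "v \<in> verts G" for v
    using assms that by simp
  obtain n where "Max (graph_dist G b ` verts G) < graph_dist G b (anchor G (\<tau> n))"
    using eventually_happens[OF \<tau>(2)] by auto
  moreover have "anchor G (\<tau> n) \<in> verts G"
    using \<tau>(1) anchor_verts by (auto simp: F.MCauchy_def)
  ultimately show False using le by (meson leD)
qed

text \<open>The head of an edge may be nearer to \<open>b\<close> than its tail by 1, which accounts
  for the shifted argument.\<close>

lemma anchor_dist:
  assumes "x \<in> points G"
  shows "df x (Vertex (anchor G x)) \<le> f (max 1 (graph_dist G b (anchor G x) - 1))"
proof (cases x)
  case (Vertex v)
  then show ?thesis
    using assms F.mdist_zero[of x] floyd_function_pos[OF f] by (auto intro: less_imp_le)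
next
  case (Inner e t)
  have e: "e \<in> arcs G" "0 < t" "t < 1" using assms Inner by auto
  have "df x (Vertex (anchor G x)) \<le> \<bar>t - 0\<bar> * floyd_length G b f e"
    using W.edge_point_dist[of e t 0] e Inner by simp
  also have "\<dots> \<le> 1 * floyd_length G b f e"
    using e W.w_pos[OF e(1)] by (intro mult_right_mono) auto
  also have "\<dots> \<le> f (max 1 (graph_dist G b (anchor G x) - 1))"
  proof -
    obtain es where es: "edge_path G b es (head G e)" "length es = graph_dist G b (head G e)"
      using graph_dist_geodesic[OF b head_in_verts[OF e(1)]] by metis
    have "graph_dist G b (tail G e) \<le> graph_dist G b (head G e) + 1"
      using graph_dist_le[OF edge_path_append[OF es(1) edge_path_head_tail[OF e(1)]]] es(2) by simp
    then show ?thesis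
      unfolding mult_1 floyd_length_def using Inner by (intro floyd_function_antimono[OF f]) auto
  qed
  finally show ?thesis .
qed

text \<open>Balls are finite, so some sequence of vertices leaves all of them. By
  \<open>small_at_infinity\<close> it is Cauchy and equivalent to every representative of a boundary
  point.\<close>

lemma floyd_boundary_singleton:
  assumes "infinite (verts G)" and small: small_at_infinity
  shows "\<exists>\<xi>. floyd_boundary G b f = {\<xi>}"
proof -
  have "\<exists>v\<in>verts G. n < graph_dist G b v" for n
  proof -
    have "\<not> verts G \<subseteq> {v \<in> verts G. graph_dist G b v \<le> n}"
      using finite_graph_ball[OF b] assms(1) finite_subset by blast
    then show ?thesis by (auto simp: subset_iff not_le)
  qed
  then obtain v where v: "\<And>n. v n \<in> verts G" "\<And>n. n < graph_dist G b (v n)" by metis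
  have small': "eventually (\<lambda>n. df (Vertex (u n)) (Vertex (v n)) < e) sequentially"
    if "0 < e" and u: "\<And>n. u n \<in> verts G" "\<And>N. eventually (\<lambda>n. N < graph_dist G b (u n)) sequentially" for e u
  proof -
    obtain N where N: "\<forall>u\<in>verts G. \<forall>v\<in>verts G.
        N \<le> graph_dist G b u \<longrightarrow> N \<le> graph_dist G b v \<longrightarrow> df (Vertex u) (Vertex v) < e"
      using small \<open>0 < e\<close> unfolding small_at_infinity_def by blast
    show ?thesis
      using u(2)[of N] eventually_ge_at_top[of N]
    proof eventually_elim
      case (elim n)
      then show ?case using N u(1) v(1) v(2)[of n] by simp
    qed
  qed
  define \<sigma> :: "nat \<Rightarrow> ('v, 'e) point" where "\<sigma> n = Vertex (v n)" for n
  have \<sigma>: "F.MCauchy \<sigma>"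
    unfolding F.MCauchy_def
  proof (intro conjI allI impI)
    show "range \<sigma> \<subseteq> points G" using v by (auto simp: \<sigma>_def)
    fix e :: real assume "0 < e"
    obtain N where N: "\<forall>u\<in>verts G. \<forall>v\<in>verts G.
        N \<le> graph_dist G b u \<longrightarrow> N \<le> graph_dist G b v \<longrightarrow> df (Vertex u) (Vertex v) < e"
      using small \<open>0 < e\<close> unfolding small_at_infinity_def by blast
    have "N \<le> graph_dist G b (v n)" if "N \<le> n" for n
      using v(2)[of n] that by simp
    then show "\<exists>N. \<forall>n n'. N \<le> n \<longrightarrow> N \<le> n' \<longrightarrow> df (\<sigma> n) (\<sigma> n') < e"
      using N v(1) by (intro exI[of _ N]) (auto simp: \<sigma>_def)
  qed
  let ?\<xi> = "cauchy_rel (points G) df `` {\<sigma>}"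
  have "X = ?\<xi>" if "X \<in> floyd_boundary G b f" for X
  proof -
    obtain \<tau> where \<tau>: "X = cauchy_rel (points G) df `` {\<tau>}" "F.MCauchy \<tau>"
        "\<And>N. eventually (\<lambda>n. N < graph_dist G b (anchor G (\<tau> n))) sequentially"
      using boundary_class[OF \<open>X \<in> floyd_boundary G b f\<close>] by metis
    have P: "\<tau> n \<in> points G" for n using \<tau>(2) by (auto simp: F.MCauchy_def)
    have "(\<lambda>n. df (\<tau> n) (\<sigma> n)) \<longlonglongrightarrow> 0"
    proof (rule order_tendstoI)
      fix e :: real assume "0 < e"
      then have e: "0 < e / 2" by simp
      have "eventually (\<lambda>k. f (max 1 k) < e / 2) sequentially"
        using order_tendstoD(2)[OF floyd_function_tendsto_0[OF f] e] .
      then obtain N where N: "\<And>k. N \<le> k \<Longrightarrow> f (max 1 k) < e / 2"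
        unfolding eventually_sequentially by blast
      show "eventually (\<lambda>n. df (\<tau> n) (\<sigma> n) < e) sequentially"
        using small'[OF e anchor_verts[OF P] \<tau>(3)] \<tau>(3)[of "Suc N"]
      proof eventually_elim
        case (elim n)
        have "N \<le> graph_dist G b (anchor G (\<tau> n)) - 1" using elim(2) by simp
        from N[OF this] have "df (\<tau> n) (Vertex (anchor G (\<tau> n))) < e / 2"
          using anchor_dist[OF P[of n]] by linarith
        moreover have "df (\<tau> n) (\<sigma> n) \<le> df (\<tau> n) (Vertex (anchor G (\<tau> n))) + df (Vertex (anchor G (\<tau> n))) (\<sigma> n)"
          using P anchor_verts v by (intro F.triangle) (auto simp: \<sigma>_def)
        ultimately show ?case using elim(1) by (simp add: \<sigma>_def)
      qed
    next
      fix e :: real assume "e < 0"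
      then show "eventually (\<lambda>n. e < df (\<tau> n) (\<sigma> n)) sequentially"
        by (intro always_eventually allI) (auto intro: less_le_trans)
    qed
    then have "(\<tau>, \<sigma>) \<in> cauchy_rel (points G) df"
      using \<tau>(2) \<sigma> by (simp add: cauchy_rel_def)
    then show ?thesis unfolding \<tau>(1) by (rule equiv_class_eq[OF F.equiv_cauchy_rel])
  qed
  moreover have "?\<xi> \<in> floyd_boundary G b f"
    unfolding floyd_boundary_def Let_def
  proof
    show "?\<xi> \<in> cauchy_completion (points G) df"
      unfolding cauchy_completion_def using \<sigma> by (intro quotientI) simp
    show "?\<xi> \<notin> completion_embedding (points G) df ` points G"
    proof
      assume "?\<xi> \<in> completion_embedding (points G) df ` points G"
      then obtain x where x: "x \<in> points G" "?\<xi> = cauchy_rel (points G) df `` {\<lambda>_. x}"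
        unfolding completion_embedding_def by blast
      then have "(\<sigma>, \<lambda>_. x) \<in> cauchy_rel (points G) df"
        by (intro eq_equiv_class[OF _ F.equiv_cauchy_rel]) auto
      then have "(\<lambda>n. df (\<sigma> n) x) \<longlonglongrightarrow> 0" by (simp add: cauchy_rel_def)
      \<comment> \<open>Other vertices keep a positive distance from \<open>x\<close>, so
        convergence to \<open>x\<close> would make the sequence eventually constant.\<close>
      then have "eventually (\<lambda>n. df (\<sigma> n) x < W.isolation x) sequentially"
        using W.isolation_pos[OF x(1)] by (rule order_tendstoD)
      then have "eventually (\<lambda>n. x = Vertex (v n)) sequentially"
      proof eventually_elim
        case (elim n)
        then show ?case
          using W.vertex_isolated[OF x(1) v(1)[of n]] F.commute[of x] by (force simp: \<sigma>_def)
      qed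
      then obtain N where "\<And>n. N \<le> n \<Longrightarrow> x = Vertex (v n)"
        unfolding eventually_sequentially by blast
      \<comment> \<open>The index is large enough to force this term further from \<open>b\<close>
        than \<open>v N\<close>.\<close>
      then have "v (N + graph_dist G b (v N)) = v N"
        by (metis le_add1 order_refl point.inject(1))
      then show False using v(2)[of "N + graph_dist G b (v N)"] by simp
    qed
  qed
  ultimately show ?thesis by blast
qed

end

section \<open>Changing the generating set\<close>

lemma (in wf_digraph) connectedI:
  assumes "verts G \<noteq> {}" "\<And>u v. u \<in> verts G \<Longrightarrow> v \<in> verts G \<Longrightarrow> \<exists>es. edge_path G u es v"
  shows "Digraph_Component.connected G"
proof -
  interpret S: pair_wf_digraph "mk_symmetric G" by (rule wellformed_mk_symmetric)
  have reach: "u \<rightarrow>\<^sup>*\<^bsub>mk_symmetric G\<^esub> v" if "edge_path G u es v" for u es v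
    using that
  proof (induction es arbitrary: u)
    case Nil
    then show ?case by auto
  next
    case (Cons e es)
    then obtain x where x: "e \<in> arcs G" "{tail G e, head G e} = {u, x}" "edge_path G x es v" by auto
    then have "(u, x) \<in> parcs (mk_symmetric G)"
      by (auto simp: parcs_mk_symmetric doubleton_eq_iff)
    then show ?case using Cons.IH[OF x(3)] S.adj_reachable_trans by auto
  qed
  then show ?thesis
    using assms unfolding Digraph_Component.connected_def by (intro strongly_connectedI) (auto, metis)
qed

text \<open>Each value of \<open>n div L\<close> is taken by \<open>L\<close> consecutive
  \<open>n\<close>, so partial sums can be grouped into blocks; the truncated shift by
  \<open>L\<close> changes the series only by repeating \<open>g 0\<close> finitely often.\<close>

lemma summable_div_shift:
  fixes g :: "nat \<Rightarrow> real"
  assumes "summable g" "\<And>n. 0 \<le> g n" "0 < L"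
  shows "summable (\<lambda>n. g (n div L - L))"
proof -
  define h where "h m = g (m - L)" for m
  have "summable (\<lambda>m. h (m + L))" using assms(1) by (simp add: h_def)
  then have h: "summable h" by (simp only: summable_iff_shift)
  have h0: "0 \<le> h m" for m using assms(2) by (simp add: h_def)
  show ?thesis
  proof (rule summableI_nonneg_bounded)
    show "0 \<le> g (n div L - L)" for n by (rule assms(2))
    fix n
    \<comment> \<open>Enlarged to \<open>n * L\<close> terms, a whole number of blocks.\<close>
    have "(\<Sum>i<n. g (i div L - L)) \<le> (\<Sum>i<n * L. h (i div L))"
      unfolding h_def using assms(2,3) by (intro sum_mono2) auto
    also have "\<dots> = (\<Sum>m<n. \<Sum>i\<in>{m * L..<m * L + L}. h (i div L))"
      by (rule sum.nat_group[symmetric])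
    also have "\<dots> = (\<Sum>m<n. L * h m)"
    proof (intro sum.cong refl)
      fix m
      have "(\<Sum>i\<in>{m * L..<m * L + L}. h (i div L)) = (\<Sum>i\<in>{m * L..<m * L + L}. h m)"
      proof (intro sum.cong refl)
        fix i assume "i \<in> {m * L..<m * L + L}"
        then have "i div L = m" by (intro div_nat_eqI) (auto simp: algebra_simps)
        then show "h (i div L) = h m" by simp
      qed
      then show "(\<Sum>i\<in>{m * L..<m * L + L}. h (i div L)) = L * h m" by simp
    qed
    also have "\<dots> = L * (\<Sum>m<n. h m)" by (simp add: sum_distrib_left)
    also have "\<dots> \<le> L * suminf h"
      using sum_le_suminf[OF h, of "{..<n}"] h0 by (intro mult_left_mono) auto
    finally show "(\<Sum>i<n. g (i div L - L)) \<le> L * suminf h" .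
  qed
qed

text \<open>The argument \<open>max 1 (n div L - L)\<close> grows by 0 or 1 in each step, so every
  ratio is 1 or one of the ratios of \<open>f\<close>, and the same \<open>K\<close> works.\<close>

lemma floyd_function_rescale:
  assumes f: "floyd_function f" and "0 < L"
  shows "floyd_function (\<lambda>n. f (max 1 (n div L - L)))"
proof -
  obtain K where K: "K \<ge> 1" "\<forall>n\<ge>1. 1 \<le> f n / f (n + 1) \<and> f n / f (n + 1) \<le> K"
    using f unfolding floyd_function_def by blast
  have pos: "0 < f (max 1 n)" for n by (rule floyd_function_pos[OF f])
  have ratio: "1 \<le> f (max 1 (n div L - L)) / f (max 1 ((n + 1) div L - L)) \<and>
      f (max 1 (n div L - L)) / f (max 1 ((n + 1) div L - L)) \<le> K" for n
  proof -
    have "(n + 1) div L = n div L \<or> (n + 1) div L = n div L + 1"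
      using div_Suc[of n L] \<open>0 < L\<close> by auto
    then have "max 1 ((n + 1) div L - L) = max 1 (n div L - L) \<or>
        max 1 ((n + 1) div L - L) = max 1 (n div L - L) + 1"
      by auto
    then show ?thesis
    proof
      assume *: "max 1 ((n + 1) div L - L) = max 1 (n div L - L)"
      show ?thesis unfolding * using pos[of "n div L - L"] K(1) by simp
    next
      assume *: "max 1 ((n + 1) div L - L) = max 1 (n div L - L) + 1"
      show ?thesis unfolding * using K(2) by simp
    qed
  qed
  have "summable (\<lambda>n. f (max 1 (n div L - L)))"
    using floyd_function_summable[OF f] pos \<open>0 < L\<close>
    by (intro summable_div_shift[where g = "\<lambda>n. f (max 1 n)"]) (auto intro: less_imp_le)
  then have "summable (\<lambda>n. f (max 1 (Suc n div L - L)))"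
    by (subst summable_Suc_iff)
  with ratio pos K(1) show ?thesis
    unfolding floyd_function_def by blast
qed

text \<open>
  Where \<open>n div L - L\<close> comes from: passing from \<open>X\<close> to \<open>X'\<close> shrinks distances from \<open>b\<close> by at most
  the factor \<open>L\<close>, and the path that replaces an edge strays at most \<open>L\<close> from its start.
\<close>

lemma small_at_infinity_transfer:
  fixes X :: "('v, 'e) pre_digraph" and X' :: "('v, 'd) pre_digraph"
  assumes X: "floyd_graph X b (\<lambda>n. f (max 1 (n div L - L)))" and X': "floyd_graph X' b f"
    and L: "0 < L"
    and fwd: "\<And>e. e \<in> arcs X \<Longrightarrow> \<exists>es. edge_path X' (tail X e) es (head X e) \<and> length es \<le> L"
    and bwd: "\<And>e. e \<in> arcs X' \<Longrightarrow> \<exists>es. edge_path X (tail X' e) es (head X' e) \<and> length es \<le> L"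
    and verts: "verts X = verts X'"
    and small: "floyd_graph.small_at_infinity X b (\<lambda>n. f (max 1 (n div L - L)))"
  shows "floyd_graph.small_at_infinity X' b f"
proof -
  let ?f = "\<lambda>n. f (max 1 (n div L - L))"
  interpret X: floyd_graph X b ?f by (rule X)
  interpret X': floyd_graph X' b f by (rule X')
  \<comment> \<open>Formulated for two arbitrary graphs because edges are replaced in both
    directions between \<open>X\<close> and \<open>X'\<close>.\<close>
  have transfer: "\<exists>fs. edge_path H' u fs v \<and> length fs \<le> L * length es"
    if H: "edge_path H u es v" "wf_digraph H" "wf_digraph H'" "verts H = verts H'"
      "\<And>e. e \<in> arcs H \<Longrightarrow> \<exists>es. edge_path H' (tail H e) es (head H e) \<and> length es \<le> L"
    for H :: "('v, 'e1) pre_digraph" and H' :: "('v, 'e2) pre_digraph" and u es v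
    using H(1)
  proof (induction es arbitrary: u)
    case Nil
    then show ?case using H(4) by (intro exI[of _ "[]"]) auto
  next
    case (Cons e es)
    then obtain x where x: "e \<in> arcs H" "{tail H e, head H e} = {u, x}" "edge_path H x es v" by auto
    obtain gs where gs: "edge_path H' (tail H e) gs (head H e)" "length gs \<le> L"
      using H(5)[OF x(1)] by blast
    have "\<exists>gs. edge_path H' u gs x \<and> length gs \<le> L"
    proof (cases "u = tail H e \<and> x = head H e")
      case True
      then show ?thesis using gs by blast
    next
      case False
      then have "u = head H e" "x = tail H e" using x(2) by (auto simp: doubleton_eq_iff)
      then show ?thesis
        using gs wf_digraph.edge_path_rev[OF H(3) gs(1)] by (intro exI[of _ "rev gs"]) simp
    qed
    moreover obtain fs where "edge_path H' x fs v" "length fs \<le> L * length es"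
      using Cons.IH[OF x(3)] by blast
    ultimately obtain gs where "edge_path H' u (gs @ fs) v" "length (gs @ fs) \<le> L * length (e # es)"
      using wf_digraph.edge_path_append[OF H(3)] by (metis add_mono length_Cons length_append mult_Suc_right)
    then show ?case by blast
  qed
  have dist: "graph_dist X b v \<le> L * graph_dist X' b v" "graph_dist X' b v \<le> L * graph_dist X b v"
    if v: "v \<in> verts X" for v
  proof -
    have v': "v \<in> verts X'" using v verts by simp
    obtain es where "edge_path X' b es v" "length es = graph_dist X' b v"
      using X'.graph_dist_geodesic[OF X'.b v'] by blast
    moreover from this obtain fs where "edge_path X b fs v" "length fs \<le> L * length es"
      using transfer[OF _ X'.wf_digraph_axioms X.wf_digraph_axioms verts[symmetric] bwd] by blast
    ultimately show "graph_dist X b v \<le> L * graph_dist X' b v"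
      using X.graph_dist_le[of b fs v] by simp
    obtain es where "edge_path X b es v" "length es = graph_dist X b v"
      using X.graph_dist_geodesic[OF X.b v] by blast
    moreover from this obtain fs where "edge_path X' b fs v" "length fs \<le> L * length es"
      using transfer[OF _ X.wf_digraph_axioms X'.wf_digraph_axioms verts fwd] by blast
    ultimately show "graph_dist X' b v \<le> L * graph_dist X b v"
      using X'.graph_dist_le[of b fs v] by simp
  qed
  have edge: "X'.df (Vertex (tail X e)) (Vertex (head X e)) \<le> L * floyd_length X b ?f e"
    if e: "e \<in> arcs X" for e
  proof -
    obtain es where es: "edge_path X' (tail X e) es (head X e)" "length es \<le> L"
      using fwd[OF e] by blast
    define m where "m = min (graph_dist X b (tail X e)) (graph_dist X b (head X e))"
    have vt: "tail X e \<in> verts X" using e by simp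
    have far: "m div L - L \<le> graph_dist X' b z" if z: "e' \<in> set es" "z \<in> {tail X' e', head X' e'}" for e' z
    proof -
      obtain fs where fs: "edge_path X' (tail X e) fs z" "length fs \<le> length es"
        using X'.edge_path_endpoint[OF es(1) z] by blast
      obtain gs where gs: "edge_path X' b gs z" "length gs = graph_dist X' b z"
        using X'.graph_dist_geodesic[OF X'.b] X'.edge_path_verts[OF fs(1)] by metis
      have "graph_dist X' b (tail X e) \<le> graph_dist X' b z + L"
        using X'.graph_dist_le[OF X'.edge_path_append[OF gs(1) X'.edge_path_rev[OF fs(1)]]] gs(2) fs(2) es(2)
        by simp
      moreover have "m div L \<le> graph_dist X' b (tail X e)"
      proof -
        have "m \<le> L * graph_dist X' b (tail X e)"
          using dist(1)[OF vt] by (simp add: m_def)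
        then have "m div L \<le> L * graph_dist X' b (tail X e) div L" by (rule div_le_mono)
        then show ?thesis using L by simp
      qed
      ultimately show ?thesis by simp
    qed
    \<comment> \<open>\<open>floyd_length\<close> evaluates at \<open>max 1 m\<close>. For
      \<open>m = 0\<close> this means \<open>1 div L\<close> instead of 0, but the truncated
      difference with \<open>L\<close> is 0 in both cases.\<close>
    have same: "max 1 (max 1 m div L - L) = max 1 (m div L - L)"
    proof (cases "m = 0")
      case True
      have "1 div L \<le> (1::nat)" by (rule div_le_dividend)
      then have "1 div L \<le> L" using L by linarith
      then show ?thesis using True by simp
    qed (simp add: max_def)
    have "X'.df (Vertex (tail X e)) (Vertex (head X e)) \<le> sum_list (map (floyd_length X' b f) es)"
      by (rule X'.W.path_metric_edge_path[OF es(1)])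
    also have "\<dots> \<le> sum_list (map (\<lambda>_. f (max 1 (m div L - L))) es)"
    proof (rule sum_list_mono)
      fix e' assume "e' \<in> set es"
      then show "floyd_length X' b f e' \<le> f (max 1 (m div L - L))"
        unfolding floyd_length_def using far[of e'] by (intro floyd_function_antimono[OF X'.f]) auto
    qed
    also have "\<dots> = length es * f (max 1 (m div L - L))" by (simp add: sum_list_triv)
    also have "\<dots> \<le> L * f (max 1 (m div L - L))"
      using es(2) floyd_function_pos[OF X'.f, of "m div L - L"] by (intro mult_right_mono) auto
    also have "\<dots> = L * floyd_length X b ?f e"
      unfolding floyd_length_def m_def[symmetric] same ..
    finally show ?thesis .
  qed
  have path: "X'.df (Vertex u) (Vertex v) \<le> L * sum_list (map (floyd_length X b ?f) es)"
    if "edge_path X u es v" for u es v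
    using that
  proof (induction es arbitrary: u)
    case Nil
    then have "u = v" "u \<in> verts X'" using verts by auto
    then show ?case using X'.F.mdist_zero[of "Vertex u"] by simp
  next
    case (Cons e es)
    then obtain x where x: "e \<in> arcs X" "{tail X e, head X e} = {u, x}" "edge_path X x es v" by auto
    have V: "u \<in> verts X'" "x \<in> verts X'" "v \<in> verts X'"
      using X.edge_path_verts[OF x(3)] X.edge_path_verts[OF Cons.prems] verts by auto
    have "X'.df (Vertex u) (Vertex x) = X'.df (Vertex (tail X e)) (Vertex (head X e))"
      using x(2) X'.F.commute by (auto simp: doubleton_eq_iff)
    then have "X'.df (Vertex u) (Vertex x) \<le> L * floyd_length X b ?f e"
      using edge[OF x(1)] by simp
    moreover have "X'.df (Vertex u) (Vertex v) \<le> X'.df (Vertex u) (Vertex x) + X'.df (Vertex x) (Vertex v)"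
      using V by (intro X'.F.triangle) auto
    ultimately show ?case using Cons.IH[OF x(3)] by (simp add: algebra_simps)
  qed
  have lipschitz: "X'.df (Vertex u) (Vertex v) \<le> L * X.df (Vertex u) (Vertex v)"
    if uv: "u \<in> verts X" "v \<in> verts X" for u v
  proof -
    have "X'.df (Vertex u) (Vertex v) / L \<le> X.df (Vertex u) (Vertex v)"
    proof (rule X.W.path_metric_greatest)
      fix r assume "r \<in> routes X (floyd_length X b ?f) (Vertex u) (Vertex v)"
      then show "X'.df (Vertex u) (Vertex v) / L \<le> r"
        using path[of u _ v] L by (cases rule: routesE) (auto simp: pos_divide_le_eq mult.commute)
    qed (use uv in auto)
    then show ?thesis using L by (simp add: pos_divide_le_eq mult.commute)
  qed
  show ?thesis
    unfolding X'.small_at_infinity_def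
  proof (intro allI impI)
    fix e :: real assume "0 < e"
    then have "0 < e / L" using L by simp
    then obtain N where N: "\<forall>u\<in>verts X. \<forall>v\<in>verts X.
        N \<le> graph_dist X b u \<longrightarrow> N \<le> graph_dist X b v \<longrightarrow> X.df (Vertex u) (Vertex v) < e / L"
      using small unfolding X.small_at_infinity_def by blast
    have "X'.df (Vertex u) (Vertex v) < e"
      if "u \<in> verts X'" "v \<in> verts X'" "L * N \<le> graph_dist X' b u" "L * N \<le> graph_dist X' b v" for u v
    proof -
      have uv: "u \<in> verts X" "v \<in> verts X" using that verts by auto
      have "N \<le> graph_dist X b u" "N \<le> graph_dist X b v"
        using that(3,4) dist(2)[OF uv(1)] dist(2)[OF uv(2)] L by (meson mult_le_cancel1 order_trans)+
      then have "X.df (Vertex u) (Vertex v) < e / L" using N uv by blast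
      then have "L * X.df (Vertex u) (Vertex v) < e" using L by (simp add: pos_less_divide_eq mult.commute)
      then show ?thesis using lipschitz[OF uv] by simp
    qed
    then show "\<exists>N. \<forall>u\<in>verts X'. \<forall>v\<in>verts X'.
        N \<le> graph_dist X' b u \<longrightarrow> N \<le> graph_dist X' b v \<longrightarrow> X'.df (Vertex u) (Vertex v) < e"
      by blast
  qed
qed

section \<open>Cayley graphs\<close>

context group
begin

lemma cayley_simps [simp]:
  "verts (cayley_graph G S) = carrier G" "arcs (cayley_graph G S) = carrier G \<times> S"
  "tail (cayley_graph G S) (g, s) = g" "head (cayley_graph G S) (g, s) = g \<otimes> s"
  by (simp_all add: cayley_graph_def)

lemma wf_cayley: "S \<subseteq> carrier G \<Longrightarrow> wf_digraph (cayley_graph G S)"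
  by unfold_locales auto

text \<open>A word for \<open>h\<close> can be read off from any starting point, so its length is a
  bound independent of \<open>g\<close>.\<close>

lemma cayley_word:
  assumes S: "S \<subseteq> carrier G" and h: "h \<in> generate G S"
  shows "\<exists>n. \<forall>g\<in>carrier G. \<exists>es. edge_path (cayley_graph G S) g es (g \<otimes> h) \<and> length es \<le> n"
  using h
proof (induction h rule: generate.induct)
  case one
  show ?case by (intro exI[of _ 0] ballI exI[of _ "[]"]) simp
next
  case (incl h)
  show ?case
    using incl S by (intro exI[of _ 1] ballI exI[of _ "[(_, h)]"]) auto
next
  case (inv h)
  have "\<exists>es. edge_path (cayley_graph G S) g es (g \<otimes> inv h) \<and> length es \<le> 1" if "g \<in> carrier G" for g
  proof -
    have "h \<in> carrier G" using inv S by blast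
    then show ?thesis
      \<comment> \<open>The inverse of a generator is an edge run against its orientation, namely
        the one starting at \<open>g \<otimes> inv h\<close>.\<close>
      using that inv by (intro exI[of _ "[(g \<otimes> inv h, h)]"]) (auto simp: m_assoc)
  qed
  then show ?case by blast
next
  case (eng h1 h2)
  interpret wf_digraph "cayley_graph G S" by (rule wf_cayley[OF S])
  have h: "h1 \<in> carrier G" "h2 \<in> carrier G"
    using generate_in_carrier[OF S] eng by auto
  obtain n1 where n1: "\<And>g. g \<in> carrier G \<Longrightarrow> \<exists>es. edge_path (cayley_graph G S) g es (g \<otimes> h1) \<and> length es \<le> n1"
    using eng by blast
  obtain n2 where n2: "\<And>g. g \<in> carrier G \<Longrightarrow> \<exists>es. edge_path (cayley_graph G S) g es (g \<otimes> h2) \<and> length es \<le> n2"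
    using eng by blast
  have "\<exists>es. edge_path (cayley_graph G S) g es (g \<otimes> (h1 \<otimes> h2)) \<and> length es \<le> n1 + n2" if g: "g \<in> carrier G" for g
  proof -
    obtain es where es: "edge_path (cayley_graph G S) g es (g \<otimes> h1)" "length es \<le> n1"
      using n1[OF g] by blast
    obtain fs where fs: "edge_path (cayley_graph G S) (g \<otimes> h1) fs (g \<otimes> h1 \<otimes> h2)" "length fs \<le> n2"
      using n2[of "g \<otimes> h1"] g h by blast
    show ?thesis
      using edge_path_append[OF es(1) fs(1)] es(2) fs(2) g h
      by (intro exI[of _ "es @ fs"]) (simp add: m_assoc)
  qed
  then show ?case by blast
qed

lemma floyd_cayley:
  assumes S: "finite_generating_set G S" and f: "floyd_function f"
  shows "floyd_graph (cayley_graph G S) \<one> f"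
proof -
  let ?X = "cayley_graph G S"
  have S': "finite S" "S \<subseteq> carrier G" "generate G S = carrier G"
    using S by (auto simp: finite_generating_set_def)
  interpret wf_digraph ?X by (rule wf_cayley[OF S'(2)])
  have "Digraph_Component.connected ?X"
  proof (rule connectedI)
    fix u v assume "u \<in> verts ?X" "v \<in> verts ?X"
    then have "u \<in> carrier G" "inv u \<otimes> v \<in> generate G S" "u \<otimes> (inv u \<otimes> v) = v"
      using S'(3) by (auto simp: m_assoc[symmetric])
    then show "\<exists>es. edge_path ?X u es v"
      using cayley_word[OF S'(2)] by metis
  qed auto
  moreover have "locally_finite ?X"
    unfolding locally_finite_def
  proof
    fix v assume v: "v \<in> verts ?X"
    have "in_arcs ?X v \<union> out_arcs ?X v \<subseteq> (\<lambda>s. (v \<otimes> inv s, s)) ` S \<union> {v} \<times> S"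
    proof
      fix e assume e: "e \<in> in_arcs ?X v \<union> out_arcs ?X v"
      obtain g s where gs: "e = (g, s)" by (cases e)
      then have *: "g \<in> carrier G" "s \<in> carrier G" "s \<in> S" "g \<otimes> s = v \<or> g = v"
        using e S'(2) by auto
      then have "g \<otimes> s \<otimes> inv s = g" by (simp add: m_assoc)
      then have "g = v \<otimes> inv s \<or> g = v" using *(4) by auto
      then show "e \<in> (\<lambda>s. (v \<otimes> inv s, s)) ` S \<union> {v} \<times> S"
        unfolding gs using *(3) by blast
    qed
    then show "finite (in_arcs ?X v \<union> out_arcs ?X v)"
      by (rule finite_subset) (use S'(1) in auto)
  qed
  ultimately show ?thesis
    using f by unfold_locales auto
qed

text \<open>Up to left translation an edge is its generator, and there are finitely many of
  these.\<close>

lemma cayley_edges_bounded: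
  assumes S: "finite_generating_set G S" and S': "finite_generating_set G S'"
  shows "\<exists>L. \<forall>e\<in>arcs (cayley_graph G S). \<exists>es.
    edge_path (cayley_graph G S') (tail (cayley_graph G S) e) es (head (cayley_graph G S) e) \<and> length es \<le> L"
proof -
  have "\<exists>n. \<forall>g\<in>carrier G. \<exists>es. edge_path (cayley_graph G S') g es (g \<otimes> s) \<and> length es \<le> n"
    if "s \<in> S" for s
    using cayley_word[of S' s] S S' that unfolding finite_generating_set_def by blast
  then obtain n where n: "\<And>s g. s \<in> S \<Longrightarrow> g \<in> carrier G \<Longrightarrow>
      \<exists>es. edge_path (cayley_graph G S') g es (g \<otimes> s) \<and> length es \<le> n s"
    by metis
  have "n s \<le> Max (n ` S)" if "s \<in> S" for s
    using S that by (simp add: finite_generating_set_def)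
  then have "\<exists>es. edge_path (cayley_graph G S') g es (g \<otimes> s) \<and> length es \<le> Max (n ` S)"
    if "s \<in> S" "g \<in> carrier G" for s g
    using n[OF that] that(1) order_trans by blast
  then show ?thesis by (intro exI[of _ "Max (n ` S)"]) auto
qed

end

theorem mainTheorem1:
  fixes X :: "('v, 'e) pre_digraph"
    and G :: "('g, 'm) monoid_scheme"
  shows
    "(thick_graph X \<longrightarrow>
        (\<forall>f b. floyd_function f \<longrightarrow> b \<in> verts X \<longrightarrow> (\<exists>\<xi>. floyd_boundary X b f = {\<xi>}))) \<and>
     (thick_group G \<longrightarrow>
        (\<forall>f S. floyd_function f \<longrightarrow> finite_generating_set G S \<longrightarrow>
           trivial_boundary (floyd_boundary (cayley_graph G S) \<one>\<^bsub>G\<^esub> f)))"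
proof (intro conjI impI allI)
  fix f b assume X: "thick_graph X" and "floyd_function f" "b \<in> verts X"
  then interpret floyd_graph X b f
    by (intro floyd_graph.intro connected_graph.intro connected_graph_axioms.intro floyd_graph_axioms.intro)
      (auto simp: thick_graph_def)
  show "\<exists>\<xi>. floyd_boundary X b f = {\<xi>}"
    using X thick_small_at_infinity by (intro floyd_boundary_singleton) (auto simp: thick_graph_def)
next
  fix f S assume G: "thick_group G" and f: "floyd_function f" and S: "finite_generating_set G S"
  interpret group G using G by (simp add: thick_group_def)
  obtain S0 where S0: "finite_generating_set G S0"
    and thick: "thick (points (cayley_graph G S0)) (path_metric (cayley_graph G S0) (\<lambda>_. 1))"
    using G unfolding thick_group_def by blast
  interpret F: floyd_graph "cayley_graph G S" "\<one>\<^bsub>G\<^esub>" f by (rule floyd_cayley[OF S f])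
  show "trivial_boundary (floyd_boundary (cayley_graph G S) \<one>\<^bsub>G\<^esub> f)"
  proof (cases "finite (carrier G)")
    case True
    then show ?thesis using F.floyd_boundary_finite_graph by (simp add: trivial_boundary_def)
  next
    case False
    obtain L1 where L1: "\<And>e. e \<in> arcs (cayley_graph G S0) \<Longrightarrow> \<exists>es.
        edge_path (cayley_graph G S) (tail (cayley_graph G S0) e) es (head (cayley_graph G S0) e) \<and> length es \<le> L1"
      using cayley_edges_bounded[OF S0 S] by blast
    obtain L2 where L2: "\<And>e. e \<in> arcs (cayley_graph G S) \<Longrightarrow> \<exists>es.
        edge_path (cayley_graph G S0) (tail (cayley_graph G S) e) es (head (cayley_graph G S) e) \<and> length es \<le> L2"
      using cayley_edges_bounded[OF S S0] by blast
    define L where "L = Max {1, L1, L2}"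
    have L: "0 < L" "L1 \<le> L" "L2 \<le> L" by (auto simp: L_def)
    \<comment> \<open>Thickness is given for \<open>S0\<close>, while the boundary is taken for
      \<open>S\<close>. Smallness at infinity holds on the first graph for every Floyd function, in
      particular for the rescaled one, whose smallness carries over to \<open>f\<close> on the
      second graph.\<close>
    interpret F0: floyd_graph "cayley_graph G S0" "\<one>\<^bsub>G\<^esub>" "\<lambda>n. f (max 1 (n div L - L))"
      by (rule floyd_cayley[OF S0 floyd_function_rescale[OF f L(1)]])
    have "F.small_at_infinity"
    proof (rule small_at_infinity_transfer)
      show "floyd_graph (cayley_graph G S0) \<one>\<^bsub>G\<^esub> (\<lambda>n. f (max 1 (n div L - L)))"
        by (rule F0.floyd_graph_axioms)
      show "floyd_graph (cayley_graph G S) \<one>\<^bsub>G\<^esub> f"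
        by (rule F.floyd_graph_axioms)
      show "F0.small_at_infinity" by (rule F0.thick_small_at_infinity[OF thick])
      show "\<exists>es. edge_path (cayley_graph G S) (tail (cayley_graph G S0) e) es (head (cayley_graph G S0) e)
          \<and> length es \<le> L" if "e \<in> arcs (cayley_graph G S0)" for e
        using L1[OF that] L(2) order_trans by blast
      show "\<exists>es. edge_path (cayley_graph G S0) (tail (cayley_graph G S) e) es (head (cayley_graph G S) e)
          \<and> length es \<le> L" if "e \<in> arcs (cayley_graph G S)" for e
        using L2[OF that] L(3) order_trans by blast
    qed (use L in simp_all)
    then obtain \<xi> where "floyd_boundary (cayley_graph G S) \<one>\<^bsub>G\<^esub> f = {\<xi>}"
      using F.floyd_boundary_singleton False by auto
    then show ?thesis by (simp add: trivial_boundary_def)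
  qed
qed

end
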